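(* Consider the $M$-group Curie-Weiss model with coupling matrix $J$, where $J$ is either homogeneous or heterogeneous, and assume that the model is in the corresponding high temperature regime. Then $$\left(\frac{S_1}{\sqrt{N_1}},\ldots,\frac{S_M}{\sqrt{N_M}}\right)\Longrightarrow\mathcal{N}(0,C)\quad\text{as }N\to\infty,$$ where $$C=I+\sqrt{\boldsymbol\alpha}\,\Sigma\,\sqrt{\boldsymbol\alpha},$$ $I$ is the $M\times M$ identity matrix, and $\Sigma$ is the $M\times M$ matrix all of whose entries equal $\frac{\beta}{1-\beta}$ if $J$ is homogeneous, and $\Sigma=H^{-1}$ if $J$ is heterogeneous.
   Context: Setting. Fix $M\in\mathbb{N}$. For each $N$ there are group sizes $N_1,\ldots,N_M\in\mathbb{N}$ with $\sum_\lambda N_\lambda=N$, and as $N\to\infty$ each $N_\lambda\to\infty$ and $N_\lambda/N\to\alpha_\lambda$, where $\alpha_\lambda\ge 0$ (possibly $0$) and $\sum_\lambda\alpha_\lambda=1$. For a fixed positive semi-definite real symmetric $M\times M$ coupling matrix $J=(J_{\lambda\mu})$, the $M$-group Curie-Weiss model is the collection of $\{-1,1\}$-valued random variables $X_{\lambda i}$ ($1\le\lambda\le M$, $1\le i\le N_\lambda$) with $$\mathbb{P}(X_{11}=x_{11},\ldots,X_{MN_M}=x_{MN_M})=Z^{-1}\exp\Big(\frac{1}{2N}\sum_{\lambda,\mu=1}^M J_{\lambda\mu}\sum_{i=1}^{N_\lambda}\sum_{j=1}^{N_\mu}x_{\lambda i}x_{\mu j}\Big),$$ $Z$ being the normalising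 constant. Put $S_\lambda=\sum_{i=1}^{N_\lambda}X_{\lambda i}$. Notation. $\boldsymbol\alpha=\mathrm{diag}(\alpha_1,\ldots,\alpha_M)$, $\sqrt{\boldsymbol\alpha}=\mathrm{diag}(\sqrt{\alpha_1},\ldots,\sqrt{\alpha_M})$. $J$ is homogeneous if all its entries equal one constant $\beta\ge0$; its high temperature regime is $\beta<1$. $J$ is heterogeneous if it is positive definite; then $H=J^{-1}-\boldsymbol\alpha$ and the high temperature regime is the case that $H$ is positive definite. $\mathcal{N}(0,C)$ is the centred multivariate normal distribution with covariance matrix $C$; $\Longrightarrow$ denotes weak convergence of the distributions. *)

theory Defs
  imports "HOL-Probability.Probability"
begin

definition pos_semidefinite :: "real^'m^'m \<Rightarrow> bool" where
  "pos_semidefinite A \<longleftrightarrow> transpose A = A \<and> (\<forall>v. 0 \<le> v \<bullet> (A *v v))"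

definition pos_definite :: "real^'m^'m \<Rightarrow> bool" where
  "pos_definite A \<longleftrightarrow> transpose A = A \<and> (\<forall>v. v \<noteq> 0 \<longrightarrow> 0 < v \<bullet> (A *v v))"

definition diag_matrix :: "real^'m \<Rightarrow> real^'m^'m" where
  "diag_matrix v = (\<chi> i j. if i = j then v $ i else 0)"

definition const_matrix :: "real \<Rightarrow> real^'m^'m" where
  "const_matrix c = (\<chi> i j. c)"

text \<open>
  A group is a value of the finite type \<open>'m\<close>, and \<open>gs l\<close> is the number of spins in group \<open>l\<close>.
  A spin configuration maps \<open>(l, i)\<close> with \<open>1 \<le> i \<le> gs l\<close> to \<open>-1\<close> or \<open>1\<close>; it is \<open>undefined\<close> at all
  other pairs, so that the set of configurations is finite and each configuration is counted once.
\<close>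

definition spin_sites :: "('m \<Rightarrow> nat) \<Rightarrow> ('m \<times> nat) set" where
  "spin_sites gs = (SIGMA l:UNIV. {1..gs l})"

definition spin_configs :: "('m \<Rightarrow> nat) \<Rightarrow> ('m \<times> nat \<Rightarrow> real) set" where
  "spin_configs gs = spin_sites gs \<rightarrow>\<^sub>E {-1, 1}"

definition cw_weight :: "real^'m^'m \<Rightarrow> ('m \<Rightarrow> nat) \<Rightarrow> ('m \<times> nat \<Rightarrow> real) \<Rightarrow> real" where
  "cw_weight J gs x =
     exp (1 / (2 * real (\<Sum>l\<in>UNIV. gs l)) *
          (\<Sum>l\<in>UNIV. \<Sum>m\<in>UNIV. J $ l $ m * (\<Sum>i=1..gs l. \<Sum>j=1..gs m. x (l, i) * x (m, j))))"

definition cw_partition :: "real^'m^'m \<Rightarrow> ('m \<Rightarrow> nat) \<Rightarrow> real" where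
  "cw_partition J gs = (\<Sum>x\<in>spin_configs gs. cw_weight J gs x)"

locale curie_weiss = prob_space P
  for P :: "'a measure" and J :: "real^'m^'m" and gs :: "'m \<Rightarrow> nat"
    and X :: "'m \<Rightarrow> nat \<Rightarrow> 'a \<Rightarrow> real" +
  assumes spin_measurable: "\<And>l i. i \<in> {1..gs l} \<Longrightarrow> X l i \<in> borel_measurable P"
    and spin_values: "\<And>l i \<omega>. i \<in> {1..gs l} \<Longrightarrow> \<omega> \<in> space P \<Longrightarrow> X l i \<omega> \<in> {-1, 1}"
    and spin_law: "\<And>x. x \<in> spin_configs gs \<Longrightarrow>
      measure P {\<omega> \<in> space P. \<forall>l. \<forall>i\<in>{1..gs l}. X l i \<omega> = x (l, i)}
        = cw_weight J gs x / cw_partition J gs"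

definition normalized_spin_sums ::
    "('m \<Rightarrow> nat) \<Rightarrow> ('m \<Rightarrow> nat \<Rightarrow> 'a \<Rightarrow> real) \<Rightarrow> 'a \<Rightarrow> real^'m" where
  "normalized_spin_sums gs X \<omega> = (\<chi> l. (\<Sum>i=1..gs l. X l i \<omega>) / sqrt (real (gs l)))"

text \<open>
  The library's \<open>weak_conv_m\<close> is formulated with distribution functions on the real line; in several
  dimensions weak convergence is convergence of the integrals of bounded continuous functions.
\<close>

definition weakly_converges :: "(nat \<Rightarrow> 'b::topological_space measure) \<Rightarrow> 'b measure \<Rightarrow> bool" where
  "weakly_converges \<mu> \<nu> \<longleftrightarrow>
     (\<forall>f :: 'b \<Rightarrow> real. continuous_on UNIV f \<and> bounded (range f) \<longrightarrow>
        (\<lambda>n. \<integral>x. f x \<partial>\<mu> n) \<longlonglongrightarrow> (\<integral>x. f x \<partial>\<nu>))"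

text \<open>
  The density formula is meaningful only for positive definite \<open>C\<close>.  This is no restriction for
  \<open>C = I + \<surd>\<alpha> \<Sigma> \<surd>\<alpha>\<close> with \<open>\<Sigma>\<close> positive semi-definite.
\<close>

definition centred_normal :: "real^'m^'m \<Rightarrow> (real^'m) measure" where
  "centred_normal C = density lborel (\<lambda>x. ennreal
     (exp (- (x \<bullet> (matrix_inv C *v x)) / 2) / sqrt ((2 * pi) ^ CARD('m) * det C)))"

definition homogeneous_coupling :: "real^'m^'m \<Rightarrow> real \<Rightarrow> bool" where
  "homogeneous_coupling J \<beta> \<longleftrightarrow> 0 \<le> \<beta> \<and> J = const_matrix \<beta>"

definition heterogeneous_coupling :: "real^'m^'m \<Rightarrow> bool" where
  "heterogeneous_coupling J \<longleftrightarrow> pos_definite J"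

definition H_matrix :: "real^'m^'m \<Rightarrow> real^'m \<Rightarrow> real^'m^'m" where
  "H_matrix J \<alpha> = matrix_inv J - diag_matrix \<alpha>"

end

theory Submission
  imports Defs
begin

text \<open>
  Let \<open>W\<close> be the vector of normalised group sums. The model tilts the law of independent fair spins
  by \<open>exp (W \<bullet> A\<^sub>N W / 2)\<close>, where \<open>A\<^sub>N = \<surd>a\<^sub>N J \<surd>a\<^sub>N\<close>, \<open>a\<^sub>N\<close> is the diagonal matrix of the proportions
  \<open>N\<^sub>l / N\<close>, and \<open>A\<^sub>N\<close> tends to \<open>A = \<surd>\<alpha> J \<surd>\<alpha>\<close>. Under the free spins the coordinates of \<open>W\<close> are
  independent, so the one-dimensional central limit theorem and Skorohod's theorem, applied to each
  coordinate of a product space, realise \<open>W\<close> as a pointwise convergent sequence with a standard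
  normal limit. The high temperature condition says that \<open>A\<close> is less than the identity, so eventually
  \<open>w \<bullet> A\<^sub>N w \<le> d (w \<bullet> w)\<close> with a fixed \<open>d < 1\<close>. The resulting upper bound for the tilt is a product
  over the groups, and each factor has a moment of order greater than 1 which is bounded in \<open>N\<close>;
  hence the tilted expectations converge. The limit has a density proportional to
  \<open>exp (- z \<bullet> (I - A) z / 2)\<close>, and \<open>(I - A)\<^sup>-\<^sup>1 = I + \<surd>\<alpha> \<Sigma> \<surd>\<alpha>\<close>.
\<close>

section \<open>Convergence of integrals under a moment bound\<close>

text \<open>Beyond the clamp the error is at most \<open>\<bar>x\<bar>\<close>, which splits into
  \<open>\<bar>x\<bar> powr (1 - p)\<close> and \<open>\<bar>x\<bar> powr p\<close>; since
  \<open>1 - p\<close> is not positive, the first factor is at most its value at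
  \<open>L\<close>.\<close>

lemma abs_diff_clamp_le:
  fixes x p L :: real
  assumes "1 \<le> p" "0 < L"
  shows "\<bar>x - max (- L) (min L x)\<bar> \<le> L powr (1 - p) * \<bar>x\<bar> powr p"
proof (cases "\<bar>x\<bar> \<le> L")
  case True
  then have "max (- L) (min L x) = x" by auto
  then show ?thesis by simp
next
  case False
  then have *: "\<bar>x - max (- L) (min L x)\<bar> \<le> \<bar>x\<bar>"
    using assms by (auto simp: max_def min_def)
  also have "\<bar>x\<bar> = \<bar>x\<bar> powr (1 - p) * \<bar>x\<bar> powr p"
    using False assms by (simp flip: powr_add)
  also have "\<dots> \<le> L powr (1 - p) * \<bar>x\<bar> powr p"
    using False assms by (intro mult_right_mono powr_mono2') auto
  finally show ?thesis .
qed

text \<open>The function is dominated by \<open>1 + \<bar>h x\<bar> powr p\<close>, and constants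
  are integrable for a finite measure.\<close>

lemma (in finite_measure) moment_bound_imp_integrable:
  fixes h :: "'a \<Rightarrow> real"
  assumes [measurable]: "h \<in> borel_measurable M" and "1 \<le> p"
    and bound: "(\<integral>\<^sup>+x. ennreal (\<bar>h x\<bar> powr p) \<partial>M) \<le> ennreal B"
  shows "integrable M (\<lambda>x. \<bar>h x\<bar> powr p)" "integrable M h"
proof -
  show 1: "integrable M (\<lambda>x. \<bar>h x\<bar> powr p)"
    using bound by (intro integrableI_nonneg) (auto intro: order.strict_trans1)
  show "integrable M h"
  proof (rule Bochner_Integration.integrable_bound)
    show "integrable M (\<lambda>x. 1 + \<bar>h x\<bar> powr p)"
      using 1 by simp
    show "AE x in M. norm (h x) \<le> norm (1 + \<bar>h x\<bar> powr p)"
    proof (rule AE_I2)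
      fix x
      show "norm (h x) \<le> norm (1 + \<bar>h x\<bar> powr p)"
      proof (cases "\<bar>h x\<bar> \<le> 1")
        case True
        have "0 \<le> \<bar>h x\<bar> powr p" by simp
        with True show ?thesis by (simp del: powr_ge_zero)
      next
        case False
        then have "\<bar>h x\<bar> powr 1 \<le> \<bar>h x\<bar> powr p"
          using \<open>1 \<le> p\<close> by (intro powr_mono) auto
        then show ?thesis using False by simp
      qed
    qed
  qed simp
qed

text \<open>The bound depends on \<open>h\<close> only through \<open>B\<close>, so it is uniform
  along a sequence with bounded moments; for \<open>p > 1\<close> it vanishes as \<open>L\<close>
  grows.\<close>

lemma (in finite_measure) moment_bound_integral_diff_clamp_le:
  fixes h :: "'a \<Rightarrow> real"
  assumes [measurable]: "h \<in> borel_measurable M" and "1 \<le> p" "0 < L" "0 \<le> B"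
    and bound: "(\<integral>\<^sup>+x. ennreal (\<bar>h x\<bar> powr p) \<partial>M) \<le> ennreal B"
  shows "\<bar>(\<integral>x. h x \<partial>M) - (\<integral>x. max (- L) (min L (h x)) \<partial>M)\<bar> \<le> L powr (1 - p) * B"
proof -
  note int = moment_bound_imp_integrable[OF assms(1,2) bound]
  have int_clamp: "integrable M (\<lambda>x. max (- L) (min L (h x)))"
    by (rule integrable_const_bound[where B = L]) (use \<open>0 < L\<close> in auto)
  have "\<bar>(\<integral>x. h x \<partial>M) - (\<integral>x. max (- L) (min L (h x)) \<partial>M)\<bar>
      = \<bar>\<integral>x. h x - max (- L) (min L (h x)) \<partial>M\<bar>"
    using int int_clamp by simp
  also have "\<dots> \<le> (\<integral>x. \<bar>h x - max (- L) (min L (h x))\<bar> \<partial>M)"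
    by (rule integral_abs_bound)
  also have "\<dots> \<le> (\<integral>x. L powr (1 - p) * \<bar>h x\<bar> powr p \<partial>M)"
    using int int_clamp assms
    by (intro integral_mono integrable_abs Bochner_Integration.integrable_diff abs_diff_clamp_le) auto
  also have "\<dots> = L powr (1 - p) * (\<integral>x. \<bar>h x\<bar> powr p \<partial>M)"
    by simp
  also have "(\<integral>x. \<bar>h x\<bar> powr p \<partial>M) \<le> B"
    using bound int \<open>0 \<le> B\<close> by (subst (asm) nn_integral_eq_integral) auto
  finally show ?thesis by (simp add: mult_left_mono)
qed

text \<open>A form of Vitali's theorem: bounded moments of an order above 1 give uniform
  integrability. Clamped integrals converge by dominated convergence, and the cost of clamping is
  uniform in large \<open>n\<close>.\<close>

lemma (in finite_measure) tendsto_integral_of_moment_bound: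
  fixes h :: "nat \<Rightarrow> 'a \<Rightarrow> real"
  assumes [measurable]: "\<And>n. h n \<in> borel_measurable M" "g \<in> borel_measurable M"
    and lim: "\<And>x. x \<in> space M \<Longrightarrow> (\<lambda>n. h n x) \<longlonglongrightarrow> g x"
    and "1 < p" "0 \<le> B"
    and bound: "\<forall>\<^sub>F n in sequentially. (\<integral>\<^sup>+x. ennreal (\<bar>h n x\<bar> powr p) \<partial>M) \<le> ennreal B"
  shows "(\<lambda>n. \<integral>x. h n x \<partial>M) \<longlonglongrightarrow> (\<integral>x. g x \<partial>M)"
proof -
  \<comment> \<open>Fatou's lemma passes the moment bound on to the limit \<open>g\<close>.\<close>
  have "(\<integral>\<^sup>+x. ennreal (\<bar>g x\<bar> powr p) \<partial>M)
      = (\<integral>\<^sup>+x. liminf (\<lambda>n. ennreal (\<bar>h n x\<bar> powr p)) \<partial>M)"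
    using \<open>1 < p\<close> lim
    by (intro nn_integral_cong lim_imp_Liminf[symmetric] tendsto_ennrealI tendsto_powr2
        tendsto_rabs tendsto_const) auto
  also have "\<dots> \<le> liminf (\<lambda>n. \<integral>\<^sup>+x. ennreal (\<bar>h n x\<bar> powr p) \<partial>M)"
    by (rule nn_integral_liminf) simp
  also have "\<dots> \<le> limsup (\<lambda>n. \<integral>\<^sup>+x. ennreal (\<bar>h n x\<bar> powr p) \<partial>M)"
    by (rule Liminf_le_Limsup) simp
  also have "\<dots> \<le> ennreal B"
    using bound by (rule Limsup_bounded)
  finally have bound_g: "(\<integral>\<^sup>+x. ennreal (\<bar>g x\<bar> powr p) \<partial>M) \<le> ennreal B" .
  define I where "I L u = (\<integral>x. max (- L) (min L (u x)) \<partial>M)" for L :: real and u :: "'a \<Rightarrow> real"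
  have I_lim: "(\<lambda>n. I L (h n)) \<longlonglongrightarrow> I L g" if "0 < L" for L
    unfolding I_def
    by (rule integral_dominated_convergence[where w = "\<lambda>_. L"])
       (use that lim in \<open>auto intro!: tendsto_intros\<close>)
  show ?thesis
  proof (rule LIMSEQ_I)
    fix e :: real assume "0 < e"
    \<comment> \<open>The error is split into three: clamping \<open>h n\<close>, clamping
      \<open>g\<close>, and the difference of the clamped integrals. The level \<open>L\<close> is
      fixed before \<open>n\<close>.\<close>
    have "((\<lambda>L. L powr (1 - p) * B) \<longlongrightarrow> 0 * B) at_top"
      using \<open>1 < p\<close> by (intro tendsto_intros tendsto_neg_powr filterlim_ident) auto
    then have "\<forall>\<^sub>F L in at_top. L powr (1 - p) * B < e / 3 \<and> 0 < L"
      using \<open>0 < e\<close> by (intro eventually_conj order_tendstoD(2)[where y = 0] eventually_gt_at_top) auto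
    then obtain L where L: "L powr (1 - p) * B < e / 3" "0 < L"
      by (auto simp: eventually_at_top_linorder)
    have "\<forall>\<^sub>F n in sequentially. \<bar>I L (h n) - I L g\<bar> < e / 3"
      using tendstoD[OF I_lim[OF L(2)], of "e / 3"] \<open>0 < e\<close> by (simp add: dist_real_def)
    then have "\<forall>\<^sub>F n in sequentially. norm ((\<integral>x. h n x \<partial>M) - (\<integral>x. g x \<partial>M)) < e"
      using bound
    proof eventually_elim
      case (elim n)
      have "\<bar>(\<integral>x. h n x \<partial>M) - I L (h n)\<bar> \<le> L powr (1 - p) * B"
        "\<bar>(\<integral>x. g x \<partial>M) - I L g\<bar> \<le> L powr (1 - p) * B"
        unfolding I_def using \<open>1 < p\<close> \<open>0 \<le> B\<close> L elim bound_g
        by (auto intro!: moment_bound_integral_diff_clamp_le)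
      then show ?case using elim(1) L(1) by (simp; linarith)
    qed
    then show "\<exists>N. \<forall>n\<ge>N. norm ((\<integral>x. h n x \<partial>M) - (\<integral>x. g x \<partial>M)) < e"
      by (simp add: eventually_sequentially)
  qed
qed

section \<open>Normalised sums of fair coin flips\<close>

text \<open>This is Hoeffding's lemma for a fair sign: the library's logarithmic inequality with
  parameter 1/2 and step \<open>2 * b\<close>, exponentiated. Evenness of \<open>cosh\<close> covers
  negative arguments.\<close>

lemma cosh_le_exp_half_square: "cosh a \<le> exp (a\<^sup>2 / 2)" for a :: real
proof -
  have "cosh b \<le> exp (b\<^sup>2 / 2)" if "0 \<le> b" for b :: real
  proof -
    have "- (2 * b) * (1 / 2) + ln (1 + 1 / 2 * (exp (2 * b) - 1)) \<le> (2 * b)\<^sup>2 / 8"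
      using that by (intro Hoeffdings_lemma_aux) auto
    then have "exp (- b + ln (1 + 1 / 2 * (exp (2 * b) - 1))) \<le> exp (b\<^sup>2 / 2)"
      by (simp add: power_mult_distrib)
    also have "exp (- b + ln (1 + 1 / 2 * (exp (2 * b) - 1))) = exp (- b) * (1 + 1 / 2 * (exp (2 * b) - 1))"
      by (subst exp_add, subst exp_ln) (auto simp: add_pos_nonneg field_simps intro: add_pos_pos)
    also have "\<dots> = cosh b"
      by (simp add: cosh_def algebra_simps flip: exp_add)
    finally show ?thesis .
  qed
  from this[of "\<bar>a\<bar>"] show ?thesis by (cases "0 \<le> a") auto
qed

text \<open>Completing the square moves the mean of the density from 0 to \<open>t\<close>.\<close>

lemma nn_integral_std_normal_exp:
  "(\<integral>\<^sup>+x. ennreal (std_normal_density x * exp (t * x)) \<partial>lborel) = ennreal (exp (t\<^sup>2 / 2))"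
proof -
  have "std_normal_density x * exp (t * x) = exp (t\<^sup>2 / 2) * normal_density t 1 x" for x
    by (simp add: normal_density_def power2_eq_square field_simps flip: exp_add)
  moreover have "(\<integral>\<^sup>+x. ennreal (normal_density t 1 x) \<partial>lborel) = 1"
    by (subst nn_integral_eq_integral) auto
  ultimately show ?thesis
    by (simp add: ennreal_mult nn_integral_cmult)
qed

text \<open>The tilted density is a multiple of the centred normal density of variance
  \<open>1 / (1 - c)\<close>.\<close>

lemma nn_integral_std_normal_exp_square:
  assumes "c < 1"
  shows "(\<integral>\<^sup>+x. ennreal (std_normal_density x * exp (c / 2 * x\<^sup>2)) \<partial>lborel) = ennreal (1 / sqrt (1 - c))"
proof -
  define \<sigma> where "\<sigma> = 1 / sqrt (1 - c)"
  have "0 < \<sigma>" using assms by (simp add: \<sigma>_def)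
  have "std_normal_density x * exp (c / 2 * x\<^sup>2) = \<sigma> * normal_density 0 \<sigma> x" for x
    using assms
    by (simp add: \<sigma>_def normal_density_def power_divide real_sqrt_divide algebra_simps flip: exp_add)
  moreover have "(\<integral>\<^sup>+x. ennreal (normal_density 0 \<sigma> x) \<partial>lborel) = 1"
    using \<open>0 < \<sigma>\<close> by (subst nn_integral_eq_integral) auto
  ultimately have "(\<integral>\<^sup>+x. ennreal (std_normal_density x * exp (c / 2 * x\<^sup>2)) \<partial>lborel) = ennreal \<sigma>"
    using \<open>0 < \<sigma>\<close> by (simp add: ennreal_mult nn_integral_cmult)
  then show ?thesis by (simp add: \<sigma>_def)
qed

text \<open>One infinite sequence of flips carries the walks of all lengths, as the central limit
  theorem requires.\<close>

definition coin_flips :: "(nat \<Rightarrow> bool) measure" where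
  "coin_flips = (\<Pi>\<^sub>M i\<in>UNIV. measure_pmf (bernoulli_pmf (1 / 2)))"

definition flip_sign :: "bool \<Rightarrow> real" where
  "flip_sign b = (if b then 1 else -1)"

lemma flip_sign_simps [simp]: "flip_sign True = 1" "flip_sign False = -1"
  by (simp_all add: flip_sign_def)

definition normalized_walk :: "nat \<Rightarrow> (nat \<Rightarrow> bool) \<Rightarrow> real" where
  "normalized_walk k \<omega> = (\<Sum>i<k. flip_sign (\<omega> i)) / sqrt (real k)"

lemma prob_space_coin_flips: "prob_space coin_flips"
  unfolding coin_flips_def by (intro prob_space_PiM measure_pmf.prob_space_axioms)

interpretation coin_flips: prob_space coin_flips
  by (rule prob_space_coin_flips)

lemma measurable_coin_flips [measurable]:
  "(\<lambda>\<omega>. \<omega> i) \<in> coin_flips \<rightarrow>\<^sub>M count_space UNIV"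
  "(\<lambda>\<omega>. flip_sign (\<omega> i)) \<in> borel_measurable coin_flips"
proof -
  show 1: "(\<lambda>\<omega>. \<omega> i) \<in> coin_flips \<rightarrow>\<^sub>M count_space UNIV"
    unfolding coin_flips_def by simp
  show "(\<lambda>\<omega>. flip_sign (\<omega> i)) \<in> borel_measurable coin_flips"
    using measurable_compose[OF 1, of flip_sign borel] by simp
qed

lemma borel_measurable_normalized_walk [measurable]: "normalized_walk k \<in> borel_measurable coin_flips"
  unfolding normalized_walk_def by measurable

lemma distr_coin_flips: "distr coin_flips (count_space UNIV) (\<lambda>\<omega>. \<omega> i) = measure_pmf (bernoulli_pmf (1 / 2))"
proof -
  have "distr coin_flips (count_space UNIV) (\<lambda>\<omega>. \<omega> i) = distr coin_flips (measure_pmf (bernoulli_pmf (1 / 2))) (\<lambda>\<omega>. \<omega> i)"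
    by (intro distr_cong) auto
  also have "\<dots> = measure_pmf (bernoulli_pmf (1 / 2))"
    unfolding coin_flips_def by (rule distr_PiM_component) (auto intro: measure_pmf.prob_space_axioms)
  finally show ?thesis .
qed

lemma integral_coin_flips:
  fixes f :: "bool \<Rightarrow> real"
  shows "(\<integral>\<omega>. f (\<omega> i) \<partial>coin_flips) = (f True + f False) / 2"
proof -
  have "(\<integral>\<omega>. f (\<omega> i) \<partial>coin_flips) = (\<integral>b. f b \<partial>measure_pmf (bernoulli_pmf (1 / 2)))"
    by (subst distr_coin_flips[symmetric, of i], subst integral_distr) auto
  then show ?thesis by (simp add: field_simps)
qed

text \<open>The joint law of the coordinates is the image of the product measure under the identity,
  hence the product of the marginal laws.\<close>

lemma indep_vars_coin_flips: "coin_flips.indep_vars (\<lambda>_. count_space UNIV) (\<lambda>i \<omega>. \<omega> i) UNIV"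
proof (subst coin_flips.indep_vars_iff_distr_eq_PiM)
  have "distr coin_flips (\<Pi>\<^sub>M i\<in>UNIV. count_space UNIV) (\<lambda>\<omega>. \<lambda>i\<in>UNIV. \<omega> i)
      = distr coin_flips coin_flips (\<lambda>\<omega>. \<omega>)"
    by (intro distr_cong) (auto simp: coin_flips_def intro!: sets_PiM_cong)
  then show "distr coin_flips (\<Pi>\<^sub>M i\<in>UNIV. count_space UNIV) (\<lambda>\<omega>. \<lambda>i\<in>UNIV. \<omega> i)
      = (\<Pi>\<^sub>M i\<in>UNIV. distr coin_flips (count_space UNIV) (\<lambda>\<omega>. \<omega> i))"
    by (simp add: distr_coin_flips) (simp add: coin_flips_def)
qed auto

lemma indep_vars_flip_sign:
  "coin_flips.indep_vars (\<lambda>_. borel) (\<lambda>i \<omega>. f i (flip_sign (\<omega> i))) UNIV"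
  by (rule coin_flips.indep_vars_compose2[OF indep_vars_coin_flips]) simp

text \<open>The normalised walk is subgaussian with the constant of the standard normal law,
  uniformly in \<open>k\<close>: independence factors the integral into powers of
  \<open>cosh t\<close>.\<close>

lemma nn_integral_exp_normalized_walk_le:
  "(\<integral>\<^sup>+\<omega>. ennreal (exp (s * normalized_walk k \<omega>)) \<partial>coin_flips) \<le> ennreal (exp (s\<^sup>2 / 2))"
proof -
  define t where "t = s / sqrt (real k)"
  have "(\<integral>\<^sup>+\<omega>. ennreal (exp (s * normalized_walk k \<omega>)) \<partial>coin_flips)
      = (\<integral>\<^sup>+\<omega>. (\<Prod>i<k. ennreal (exp (t * flip_sign (\<omega> i)))) \<partial>coin_flips)"
    by (simp add: prod_ennreal normalized_walk_def t_def exp_sum sum_distrib_left sum_divide_distrib)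
  also have "\<dots> = (\<Prod>i<k. \<integral>\<^sup>+\<omega>. ennreal (exp (t * flip_sign (\<omega> i))) \<partial>coin_flips)"
    by (rule coin_flips.indep_vars_nn_integral)
       (auto intro: coin_flips.indep_vars_subset[OF indep_vars_flip_sign])
  also have "\<dots> = (\<Prod>i<k. ennreal (cosh t))"
    by (intro prod.cong refl, subst nn_integral_eq_integral)
       (auto simp: integral_coin_flips[where f = "\<lambda>b. exp (t * (if b then 1 else - 1))"] cosh_def flip_sign_def
         intro!: coin_flips.integrable_const_bound[where B = "exp \<bar>t\<bar>"])
  also have "\<dots> \<le> (\<Prod>i<k. ennreal (exp (t\<^sup>2 / 2)))"
    by (intro prod_mono_ennreal ennreal_leI cosh_le_exp_half_square)
  also have "\<dots> = ennreal (exp (k * (t\<^sup>2 / 2)))"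
    by (simp only: prod_constant card_lessThan ennreal_power exp_ge_zero exp_of_nat_mult)
  also have "\<dots> \<le> ennreal (exp (s\<^sup>2 / 2))"
    \<comment> \<open>For \<open>k = 0\<close> division by zero makes \<open>t = 0\<close> and the
      left side is 1; otherwise both sides agree.\<close>
    by (cases "k = 0") (auto simp: t_def power_divide)
  finally show ?thesis .
qed

text \<open>
  The square in the exponent is linearised by averaging \<open>exp (\<surd>c g w)\<close> over a standard normal \<open>g\<close>.
\<close>

lemma nn_integral_exp_square_normalized_walk_le:
  assumes "0 \<le> c" "c < 1"
  shows "(\<integral>\<^sup>+\<omega>. ennreal (exp (c / 2 * (normalized_walk k \<omega>)\<^sup>2)) \<partial>coin_flips) \<le> ennreal (1 / sqrt (1 - c))"
proof -
  interpret pair_sigma_finite lborel coin_flips ..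
  have "(\<integral>\<^sup>+\<omega>. ennreal (exp (c / 2 * (normalized_walk k \<omega>)\<^sup>2)) \<partial>coin_flips)
      = (\<integral>\<^sup>+\<omega>. (\<integral>\<^sup>+g. ennreal (std_normal_density g * exp (sqrt c * normalized_walk k \<omega> * g)) \<partial>lborel) \<partial>coin_flips)"
    using assms by (simp add: nn_integral_std_normal_exp power_mult_distrib)
  also have "\<dots> = (\<integral>\<^sup>+g. (\<integral>\<^sup>+\<omega>. ennreal (std_normal_density g * exp (sqrt c * normalized_walk k \<omega> * g)) \<partial>coin_flips) \<partial>lborel)"
    by (rule Fubini') measurable
  also have "\<dots> = (\<integral>\<^sup>+g. ennreal (std_normal_density g) * (\<integral>\<^sup>+\<omega>. ennreal (exp (sqrt c * g * normalized_walk k \<omega>)) \<partial>coin_flips) \<partial>lborel)"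
    by (simp add: ennreal_mult nn_integral_cmult mult_ac)
  also have "\<dots> \<le> (\<integral>\<^sup>+g. ennreal (std_normal_density g) * ennreal (exp ((sqrt c * g)\<^sup>2 / 2)) \<partial>lborel)"
    by (intro nn_integral_mono mult_left_mono nn_integral_exp_normalized_walk_le) auto
  also have "\<dots> = (\<integral>\<^sup>+x. ennreal (std_normal_density x * exp (c / 2 * x\<^sup>2)) \<partial>lborel)"
    using assms by (simp add: ennreal_mult power_mult_distrib)
  also have "\<dots> = ennreal (1 / sqrt (1 - c))"
    using assms(2) by (rule nn_integral_std_normal_exp_square)
  finally show ?thesis .
qed

lemma normalized_walk_weak_conv:
  "weak_conv_m (\<lambda>k. distr coin_flips borel (normalized_walk k)) std_normal_distribution"
proof -
  have int: "integrable coin_flips (\<lambda>\<omega>. f (flip_sign (\<omega> i)))" for f :: "real \<Rightarrow> real" and i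
    by (rule coin_flips.integrable_const_bound[where B = "\<bar>f 1\<bar> + \<bar>f (- 1)\<bar>"])
       (auto simp: flip_sign_def intro!: measurable_compose[OF measurable_coin_flips(1)])
  have eq: "(\<integral>\<omega>. f (flip_sign (\<omega> i)) \<partial>coin_flips) = (f 1 + f (-1)) / 2" for f :: "real \<Rightarrow> real" and i
    by (subst integral_coin_flips) (simp add: flip_sign_def)
  \<comment> \<open>The factor \<open>1\<^sup>2\<close> is the variance of a flip, kept in the shape
    that the central limit theorem produces.\<close>
  have "weak_conv_m (\<lambda>n. distr coin_flips borel (\<lambda>\<omega>. (\<Sum>i<n. flip_sign (\<omega> i)) / sqrt (real n * (1::real)\<^sup>2)))
          std_normal_distribution"
  proof (rule coin_flips.central_limit_theorem_zero_mean)
    show "coin_flips.indep_vars (\<lambda>i. borel) (\<lambda>i \<omega>. flip_sign (\<omega> i)) UNIV"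
      by (rule indep_vars_flip_sign)
    show "distr coin_flips borel (\<lambda>\<omega>. flip_sign (\<omega> n))
        = distr (measure_pmf (bernoulli_pmf (1 / 2))) borel flip_sign" for n
      by (subst distr_coin_flips[symmetric, of n], subst distr_distr) (auto simp: comp_def)
  qed (use int[of "\<lambda>x. x\<^sup>2"] eq[of "\<lambda>x. x"] eq[of "\<lambda>x. x\<^sup>2"] in \<open>auto\<close>)
  moreover have "(\<lambda>\<omega>. (\<Sum>i<n. flip_sign (\<omega> i)) / sqrt (real n * (1::real)\<^sup>2)) = normalized_walk n" for n
    by (simp add: normalized_walk_def fun_eq_iff)
  ultimately show ?thesis by simp
qed

text \<open>Weak convergence is traded for pointwise convergence. Only the law of each single
  \<open>Y k\<close> is that of the walk, not the joint law over \<open>k\<close>; this suffices for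
  integrals taken at one index at a time.\<close>

lemma normalized_walk_Skorohod:
  obtains \<Omega> :: "real measure" and Y :: "nat \<Rightarrow> real \<Rightarrow> real" and Z :: "real \<Rightarrow> real"
  where "prob_space \<Omega>" "\<And>k. Y k \<in> borel_measurable \<Omega>" "Z \<in> borel_measurable \<Omega>"
    "\<And>k. distr \<Omega> borel (Y k) = distr coin_flips borel (normalized_walk k)"
    "distr \<Omega> borel Z = std_normal_distribution"
    "\<And>x. x \<in> space \<Omega> \<Longrightarrow> (\<lambda>k. Y k x) \<longlonglongrightarrow> Z x"
proof -
  have "real_distribution (distr coin_flips borel (normalized_walk k))" for k
    by (rule coin_flips.real_distribution_distr) simp
  from Skorohod[OF this real_dist_normal_dist normalized_walk_weak_conv] show thesis
    by (auto intro: that)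
qed

section \<open>Gaussian integrals\<close>

lemma measurable_vec_nth [measurable]: "(\<lambda>x. x $ i) \<in> borel_measurable (borel :: (real^'n) measure)"
  by (intro borel_measurable_continuous_onI continuous_intros)

lemma measurable_vec_lambda [measurable (raw)]:
  fixes f :: "'a \<Rightarrow> 'n::finite \<Rightarrow> real"
  assumes "\<And>i. (\<lambda>x. f x i) \<in> borel_measurable M"
  shows "(\<lambda>x. vec_lambda (f x)) \<in> borel_measurable M"
proof (subst borel_measurable_euclidean_space, safe)
  fix b :: "real^'n" assume "b \<in> Basis"
  then obtain i where "b = axis i 1" by (auto simp: Basis_vec_def)
  then show "(\<lambda>x. vec_lambda (f x) \<bullet> b) \<in> borel_measurable M"
    using assms by (simp add: inner_axis)
qed

text \<open>Boxes determine Lebesgue measure, and the product measure gives a box the product of its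
  side lengths. This opens \<open>real^'n\<close> to Fubini's theorem one coordinate at a
  time.\<close>

lemma lborel_eq_distr_PiM_vec_lambda:
  "(lborel :: (real^'n) measure) = distr (\<Pi>\<^sub>M i\<in>UNIV. lborel) borel vec_lambda"
proof (rule lborel_eqI)
  interpret product_sigma_finite "\<lambda>_::'n. lborel :: real measure" ..
  fix l u :: "real^'n"
  assume le: "\<And>b. b \<in> Basis \<Longrightarrow> l \<bullet> b \<le> u \<bullet> b"
  have le': "l $ i \<le> u $ i" for i
    using le[of "axis i 1"] by (auto simp: Basis_vec_def inner_axis)
  have "emeasure (distr (\<Pi>\<^sub>M i\<in>UNIV. lborel) borel vec_lambda) (box l u)
      = emeasure (\<Pi>\<^sub>M i\<in>UNIV. lborel) (\<Pi>\<^sub>E i\<in>UNIV. {l $ i<..<u $ i})"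
    by (subst emeasure_distr)
       (auto simp: space_PiM box_def Basis_vec_def inner_axis PiE_iff intro!: arg_cong[where f = "emeasure _"])
  also have "\<dots> = (\<Prod>i\<in>UNIV. ennreal (u $ i - l $ i))"
    by (subst emeasure_PiM) (auto simp: le')
  also have "\<dots> = ennreal (\<Prod>b\<in>Basis. (u - l) \<bullet> b)"
    by (simp add: prod_ennreal le' Basis_vec_def axis_eq_axis prod.UNION_disjoint inner_axis)
  finally show "emeasure (distr (\<Pi>\<^sub>M i\<in>UNIV. lborel) borel vec_lambda) (box l u) = (\<Prod>b\<in>Basis. (u - l) \<bullet> b)" .
qed simp

lemma nn_integral_lborel_vec:
  fixes f :: "real^'n \<Rightarrow> ennreal"
  assumes [measurable]: "f \<in> borel_measurable borel"
  shows "(\<integral>\<^sup>+x. f x \<partial>lborel) = (\<integral>\<^sup>+x. f (vec_lambda x) \<partial>(\<Pi>\<^sub>M i\<in>UNIV. lborel))"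
  by (subst lborel_eq_distr_PiM_vec_lambda, subst nn_integral_distr) simp_all

text \<open>Because \<open>r $ i = 0\<close>, the shear translates coordinate \<open>i\<close> by an
  amount that depends only on the other coordinates; integrating over coordinate \<open>i\<close>
  first, translation invariance on the line applies.\<close>

lemma nn_integral_lborel_shear:
  fixes f :: "real^'n \<Rightarrow> ennreal"
  assumes [measurable]: "f \<in> borel_measurable borel" and "r $ i = 0"
  shows "(\<integral>\<^sup>+x. f (x + (r \<bullet> x) *\<^sub>R axis i 1) \<partial>lborel) = (\<integral>\<^sup>+x. f x \<partial>lborel)"
proof -
  interpret product_sigma_finite "\<lambda>_::'n. lborel :: real measure" ..
  have insert: "(\<integral>\<^sup>+x. g x \<partial>lborel)
      = (\<integral>\<^sup>+x. (\<integral>\<^sup>+y. g (vec_lambda (x(i := y))) \<partial>lborel) \<partial>(\<Pi>\<^sub>M i\<in>UNIV - {i}. lborel))"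
    if [measurable]: "g \<in> borel_measurable borel" for g :: "real^'n \<Rightarrow> ennreal"
  proof -
    have "(\<integral>\<^sup>+x. g x \<partial>lborel) = (\<integral>\<^sup>+x. g (vec_lambda x) \<partial>(\<Pi>\<^sub>M i\<in>insert i (UNIV - {i}). lborel))"
      by (simp add: nn_integral_lborel_vec insert_absorb)
    also have "\<dots> = (\<integral>\<^sup>+x. (\<integral>\<^sup>+y. g (vec_lambda (x(i := y))) \<partial>lborel) \<partial>(\<Pi>\<^sub>M i\<in>UNIV - {i}. lborel))"
      by (rule product_nn_integral_insert) (simp_all add: insert_absorb)
    finally show ?thesis .
  qed
  have "(\<integral>\<^sup>+y. f (vec_lambda (x(i := y)) + (r \<bullet> vec_lambda (x(i := y))) *\<^sub>R axis i 1) \<partial>lborel)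
      = (\<integral>\<^sup>+y. f (vec_lambda (x(i := y))) \<partial>lborel)" for x
  proof -
    define s where "s = r \<bullet> vec_lambda x"
    have "r \<bullet> vec_lambda (x(i := y)) = s" for y
      unfolding s_def inner_vec_def using \<open>r $ i = 0\<close> by (auto intro!: sum.cong)
    \<comment> \<open>The form \<open>s + 1 * y\<close> fits the rule for affine substitution on the
      line, used with slope 1.\<close>
    then have "vec_lambda (x(i := y)) + (r \<bullet> vec_lambda (x(i := y))) *\<^sub>R axis i 1 = vec_lambda (x(i := s + 1 * y))" for y
      by (auto simp: vec_eq_iff axis_def)
    moreover have "(\<lambda>y. f (vec_lambda (x(i := y)))) \<in> borel_measurable borel"
    proof -
      have "(\<lambda>y. vec_lambda (x(i := y))) \<in> borel_measurable borel"
      proof (rule measurable_vec_lambda)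
        show "(\<lambda>y. (x(i := y)) j) \<in> borel_measurable borel" for j
          by (cases "j = i") simp_all
      qed
      then show ?thesis by measurable
    qed
    ultimately show ?thesis
      by (subst (2) nn_integral_real_affine[where t = s and c = 1]) simp_all
  qed
  then show ?thesis
    by (simp add: insert)
qed

section \<open>Quadratic forms and Gaussian elimination\<close>

definition quadratic_form :: "real^'n^'n \<Rightarrow> real^'n \<Rightarrow> real" where
  "quadratic_form A x = x \<bullet> (A *v x)"

lemma continuous_on_quadratic_form [continuous_intros]: "continuous_on S (quadratic_form A)"
  unfolding quadratic_form_def by (intro continuous_intros)

lemma borel_measurable_quadratic_form [measurable]: "quadratic_form A \<in> borel_measurable borel"
  by (intro borel_measurable_continuous_onI continuous_intros)

lemma symmetric_inner_matrix_vector: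
  fixes A :: "real^'n^'n"
  assumes "transpose A = A"
  shows "x \<bullet> (A *v y) = y \<bullet> (A *v x)"
  using assms by (metis dot_lmul_matrix inner_commute transpose_matrix_vector)

lemma quadratic_form_add:
  assumes "transpose A = A"
  shows "quadratic_form A (x + y) = quadratic_form A x + 2 * (x \<bullet> (A *v y)) + quadratic_form A y"
  using symmetric_inner_matrix_vector[OF assms, of x y]
  by (simp add: quadratic_form_def matrix_vector_right_distrib inner_add_left inner_add_right)

text \<open>Polarisation: a symmetric bilinear form is recovered from its quadratic form.\<close>

lemma symmetric_matrix_eqI:
  fixes A B :: "real^'n^'n"
  assumes "transpose A = A" "transpose B = B" "\<And>x. quadratic_form A x = quadratic_form B x"
  shows "A = B"
proof -
  have "x \<bullet> (A *v y) = x \<bullet> (B *v y)" for x y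
    using quadratic_form_add[OF assms(1), of x y] quadratic_form_add[OF assms(2), of x y] assms(3) by simp
  then have "A *v y = B *v y" for y
    using vector_eq_ldot by blast
  then show ?thesis by (simp add: matrix_eq)
qed

lemma nn_integral_exp_minus_square:
  assumes "0 < q"
  shows "(\<integral>\<^sup>+x. ennreal (exp (- (q * x\<^sup>2) / 2)) \<partial>lborel) = ennreal (sqrt (2 * pi / q))"
proof -
  define \<sigma> where "\<sigma> = 1 / sqrt q"
  have "0 < \<sigma>" using assms by (simp add: \<sigma>_def)
  have "exp (- (q * x\<^sup>2) / 2) = sqrt (2 * pi / q) * normal_density 0 \<sigma> x" for x
    using assms by (simp add: \<sigma>_def normal_density_def power_divide real_sqrt_divide)
  moreover have "(\<integral>\<^sup>+x. ennreal (normal_density 0 \<sigma> x) \<partial>lborel) = 1"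
    using \<open>0 < \<sigma>\<close> by (subst nn_integral_eq_integral) auto
  ultimately show ?thesis
    using assms by (simp only: ennreal_mult normal_density_nonneg) (simp add: ennreal_mult nn_integral_cmult)
qed

lemma sqrt_prod: "sqrt (\<Prod>i\<in>A. f i) = (\<Prod>i\<in>A. sqrt (f i))"
  by (induction A rule: infinite_finite_induct) (simp_all add: real_sqrt_mult)

lemma nn_integral_gaussian_diagonal:
  fixes Q :: "real^'n^'n"
  assumes diag: "\<And>i j. i \<noteq> j \<Longrightarrow> Q $ i $ j = 0" and pos: "\<And>i. 0 < Q $ i $ i"
  shows "(\<integral>\<^sup>+x. ennreal (exp (- quadratic_form Q x / 2)) \<partial>lborel) = ennreal (sqrt ((2 * pi) ^ CARD('n) / det Q))"
proof -
  interpret product_sigma_finite "\<lambda>_::'n. lborel :: real measure" ..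
  have "(\<Sum>j\<in>UNIV. Q $ i $ j * x $ j) = Q $ i $ i * x $ i" for i and x :: "real^'n"
    by (subst sum.remove[of _ i]) (auto simp: diag intro!: sum.neutral)
  then have "quadratic_form Q x = (\<Sum>i\<in>UNIV. Q $ i $ i * (x $ i)\<^sup>2)" for x
    by (simp add: quadratic_form_def inner_vec_def matrix_vector_mult_def power2_eq_square mult_ac)
  then have "(\<integral>\<^sup>+x. ennreal (exp (- quadratic_form Q x / 2)) \<partial>lborel)
      = (\<integral>\<^sup>+x. ennreal (\<Prod>i\<in>UNIV. exp (- (Q $ i $ i * (x $ i)\<^sup>2) / 2)) \<partial>lborel)"
    by (simp add: exp_sum[symmetric] sum_negf sum_divide_distrib)
  also have "\<dots> = (\<integral>\<^sup>+x. (\<Prod>i\<in>UNIV. ennreal (exp (- (Q $ i $ i * (x i)\<^sup>2) / 2))) \<partial>(\<Pi>\<^sub>M i\<in>UNIV. lborel))"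
    by (subst nn_integral_lborel_vec) (simp_all add: prod_ennreal)
  also have "\<dots> = (\<Prod>i\<in>UNIV. ennreal (sqrt (2 * pi / Q $ i $ i)))"
    by (subst product_nn_integral_prod) (simp_all only: nn_integral_exp_minus_square pos finite_UNIV, simp_all)
  also have "\<dots> = ennreal (sqrt (\<Prod>i\<in>UNIV. 2 * pi / Q $ i $ i))"
    using pos by (simp add: prod_ennreal less_imp_le sqrt_prod)
  also have "(\<Prod>i\<in>UNIV. 2 * pi / Q $ i $ i) = (2 * pi) ^ CARD('n) / det Q"
    by (simp add: det_diagonal[OF diag] prod_dividef)
  finally show ?thesis .
qed

text \<open>Since \<open>r $ i = 0\<close>, the vector \<open>r\<close> lies in the span of the rows
  of the identity other than row \<open>i\<close>, and adding it to row \<open>i\<close> leaves the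
  determinant unchanged.\<close>

lemma det_shear:
  fixes r :: "real^'n"
  assumes "r $ i = 0"
  shows "det (\<chi> k. if k = i then axis i 1 + r else axis k 1) = 1"
proof -
  have row: "row k (mat 1) = (axis k 1 :: real^'n)" for k
    by (auto simp: row_def mat_def axis_def vec_eq_iff)
  have "r = (\<Sum>k\<in>UNIV. r $ k *s axis k 1)"
    by (simp add: basis_expansion)
  also have "\<dots> = (\<Sum>k\<in>UNIV - {i}. r $ k *s axis k 1)"
    using assms by (intro sum.mono_neutral_right) auto
  also have "\<dots> \<in> vec.span {row j (mat 1) |j. j \<noteq> i}"
    by (intro vec.span_sum vec.span_scale vec.span_base) (auto simp: row)
  finally have "det (\<chi> k. if k = i then row i (mat 1) + r else row k (mat 1)) = det (mat 1 :: real^'n^'n)"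
    by (rule det_row_span)
  then show ?thesis unfolding row by simp
qed

text \<open>
  Completing the square in the \<open>i\<close>-th variable decouples it from the others.
\<close>

lemma eliminate_variable:
  fixes Q :: "real^'n^'n" and i :: 'n
  assumes "pos_definite Q"
  defines "q \<equiv> Q $ i $ i"
  defines "r \<equiv> (\<chi> k. if k = i then 0 else Q $ k $ i / q)"
  defines "Q' \<equiv> (\<chi> j k. if j = i \<and> k = i then q else Q $ j $ k - Q $ j $ i * Q $ i $ k / q)"
  shows "pos_definite Q'" "quadratic_form Q' (x + (r \<bullet> x) *\<^sub>R axis i 1) = quadratic_form Q x" "det Q' = det Q"
proof -
  have sym: "transpose Q = Q" and pos: "\<And>v. v \<noteq> 0 \<Longrightarrow> 0 < quadratic_form Q v"
    using assms(1) by (auto simp: pos_definite_def quadratic_form_def)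
  have Q_sym: "Q $ j $ k = Q $ k $ j" for j k
    using sym by (metis transpose_def vec_lambda_beta)
  define c where "c = Q *v axis i 1"
  have c: "c $ k = Q $ k $ i" for k
    by (simp add: c_def matrix_vector_mult_basis column_def)
  have "0 < q"
    using pos[of "axis i 1"] c[of i] by (simp add: quadratic_form_def q_def c_def inner_axis' axis_eq_0_iff)
  have sym': "transpose Q' = Q'"
    by (auto simp: Q'_def transpose_def vec_eq_iff Q_sym)
  \<comment> \<open>Subtracting the rank-one form \<open>(c \<bullet> y)\<^sup>2 / q\<close> clears
    row and column \<open>i\<close>; the last term restores the diagonal entry
    \<open>q\<close>.\<close>
  have Q'_eq: "quadratic_form Q' y = quadratic_form Q y - (c \<bullet> y)\<^sup>2 / q + q * (y $ i)\<^sup>2" for y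
  proof -
    have "Q' $ j $ k = Q $ j $ k - c $ j * c $ k / q + (if j = i \<and> k = i then q else 0)" for j k
      using \<open>0 < q\<close> Q_sym by (auto simp: Q'_def c q_def)
    then have "quadratic_form Q' y = (\<Sum>j\<in>UNIV. \<Sum>k\<in>UNIV. y $ j * (Q $ j $ k - c $ j * c $ k / q
        + (if j = i \<and> k = i then q else 0)) * y $ k)"
      by (simp add: quadratic_form_def inner_vec_def matrix_vector_mult_def sum_distrib_left mult.assoc)
    also have "\<dots> = quadratic_form Q y - (\<Sum>j\<in>UNIV. \<Sum>k\<in>UNIV. (c $ j * y $ j) * (c $ k * y $ k)) / q
        + (\<Sum>j\<in>UNIV. \<Sum>k\<in>UNIV. if j = i then if k = i then q * (y $ i)\<^sup>2 else 0 else 0)"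
      unfolding quadratic_form_def inner_vec_def matrix_vector_mult_def sum_divide_distrib
      by (auto simp: sum_distrib_left algebra_simps power2_eq_square simp flip: sum.distrib sum_subtractf intro!: sum.cong)
    also have "(\<Sum>j\<in>UNIV. \<Sum>k\<in>UNIV. (c $ j * y $ j) * (c $ k * y $ k)) = (c \<bullet> y)\<^sup>2"
      by (simp add: inner_vec_def power2_eq_square sum_product)
    also have "(\<Sum>j\<in>UNIV. \<Sum>k\<in>UNIV. if j = i then if k = i then q * (y $ i)\<^sup>2 else 0 else 0) = q * (y $ i)\<^sup>2"
    proof -
      have "(\<Sum>k\<in>UNIV. if j = i then if k = i then q * (y $ i)\<^sup>2 else 0 else 0) = (if j = i then q * (y $ i)\<^sup>2 else 0)" for j
        by simp
      then show ?thesis by simp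
    qed
    finally show ?thesis .
  qed
  have r: "r = (1 / q) *\<^sub>R c - axis i 1"
    using \<open>0 < q\<close> by (auto simp: r_def c vec_eq_iff axis_def q_def)
  show shear: "quadratic_form Q' (x + (r \<bullet> x) *\<^sub>R axis i 1) = quadratic_form Q x" for x
  proof -
    define t where "t = r \<bullet> x"
    have "x $ i = (c \<bullet> x) / q - t"
      by (simp add: t_def r inner_diff_left inner_axis')
    then have cx: "c \<bullet> x = q * (x $ i + t)"
      using \<open>0 < q\<close> by (simp add: field_simps)
    have [simp]: "c $ i = q" "c \<bullet> axis i 1 = q" by (simp_all add: c q_def inner_axis)
    have "quadratic_form Q (x + t *\<^sub>R axis i 1) = quadratic_form Q x + 2 * t * (c \<bullet> x) + t\<^sup>2 * q"
      by (simp add: quadratic_form_add[OF sym] matrix_vector_mult_scaleR flip: c_def)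
         (simp add: quadratic_form_def matrix_vector_mult_scaleR inner_axis' inner_commute power2_eq_square flip: c_def)
    moreover have "c \<bullet> (x + t *\<^sub>R axis i 1) = c \<bullet> x + t * q"
      by (simp add: inner_add_right inner_axis)
    moreover have "(x + t *\<^sub>R axis i 1) $ i = x $ i + t"
      by simp
    ultimately show ?thesis
      using \<open>0 < q\<close> unfolding t_def[symmetric] Q'_eq
      by (simp add: cx power2_eq_square field_simps)
  qed
  have "r $ i = 0" by (simp add: r_def)
  show "pos_definite Q'"
    unfolding pos_definite_def
  proof (intro conjI allI impI sym')
    fix y :: "real^'n" assume "y \<noteq> 0"
    \<comment> \<open>This \<open>x\<close> is the preimage of \<open>y\<close> under the shear,
      which leaves \<open>r \<bullet> x\<close> unchanged because \<open>r $ i = 0\<close>.\<close>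
    define x where "x = y - (r \<bullet> y) *\<^sub>R axis i 1"
    have "r \<bullet> x = r \<bullet> y"
      by (simp add: x_def inner_diff_right inner_axis \<open>r $ i = 0\<close>)
    then have y: "y = x + (r \<bullet> x) *\<^sub>R axis i 1"
      by (simp add: x_def)
    with \<open>y \<noteq> 0\<close> have "x \<noteq> 0" by auto
    then show "0 < y \<bullet> (Q' *v y)"
      using pos[of x] shear[of x] y by (simp add: quadratic_form_def)
  qed
  \<comment> \<open>\<open>B\<close> is the matrix of the shear. The congruence of \<open>Q\<close>
    and \<open>Q'\<close> through \<open>B\<close>, with \<open>det B = 1\<close>, preserves the
    determinant.\<close>
  define B :: "real^'n^'n" where "B = (\<chi> k. if k = i then axis i 1 + r else axis k 1)"
  have B: "B *v x = x + (r \<bullet> x) *\<^sub>R axis i 1" for x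
  proof -
    have "(axis i 1 :: real^'n) $ k = (if k = i then 1 else 0)" for k
      by (simp add: axis_def)
    then show ?thesis
      by (simp add: B_def vec_eq_iff matrix_vector_mul_component inner_axis' inner_add_left)
  qed
  have "Q = transpose B ** Q' ** B"
  proof (rule symmetric_matrix_eqI)
    show "transpose (transpose B ** Q' ** B) = transpose B ** Q' ** B"
      by (simp add: matrix_transpose_mul sym' matrix_mul_assoc)
    show "quadratic_form Q x = quadratic_form (transpose B ** Q' ** B) x" for x
      using shear[of x]
      by (simp add: quadratic_form_def B dot_lmul_matrix[symmetric] transpose_matrix_vector flip: B matrix_vector_mul_assoc)
         (metis dot_lmul_matrix inner_commute)
  qed (rule sym)
  then have "det Q = det B * det Q' * det B"
    by (simp add: det_mul)
  moreover have "det B = 1"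
    unfolding B_def using \<open>r $ i = 0\<close> by (rule det_shear)
  ultimately show "det Q' = det Q" by simp
qed

text \<open>Variables are eliminated one by one; each elimination keeps positive definiteness, the
  determinant and, by the shear lemma, the integral, until the form is diagonal.\<close>

theorem nn_integral_gaussian:
  fixes Q :: "real^'n^'n"
  assumes "pos_definite Q"
  shows "0 < det Q"
    and "(\<integral>\<^sup>+x. ennreal (exp (- quadratic_form Q x / 2)) \<partial>lborel) = ennreal (sqrt ((2 * pi) ^ CARD('n) / det Q))"
proof -
  \<comment> \<open>\<open>U\<close> holds the coordinates that may still be coupled to each other.
    It is empty for a diagonal form, and \<open>UNIV\<close> imposes no condition.\<close>
  have "0 < det Q \<and>
      (\<integral>\<^sup>+x. ennreal (exp (- quadratic_form Q x / 2)) \<partial>lborel) = ennreal (sqrt ((2 * pi) ^ CARD('n) / det Q))"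
    if "finite U" "\<And>i j. i \<noteq> j \<Longrightarrow> i \<notin> U \<or> j \<notin> U \<Longrightarrow> Q $ i $ j = 0" for U
    using that assms
  proof (induction U arbitrary: Q rule: finite_induct)
    case empty
    have "0 < Q $ i $ i" for i
      using empty.prems(2)
      by (auto simp: pos_definite_def axis_eq_0_iff inner_axis' matrix_vector_mult_basis column_def dest!: spec[of _ "axis i 1"])
    then show ?case
      using empty.prems(1) nn_integral_gaussian_diagonal[of Q] by (simp add: det_diagonal prod_pos)
  next
    case (insert i U)
    define r where "r = (\<chi> k. if k = i then 0 else Q $ k $ i / Q $ i $ i)"
    define Q' where "Q' = (\<chi> j k. if j = i \<and> k = i then Q $ i $ i else Q $ j $ k - Q $ j $ i * Q $ i $ k / Q $ i $ i)"
    note elim = eliminate_variable[OF insert.prems(2), of i, folded r_def Q'_def]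
    have "0 < Q $ i $ i"
      using insert.prems(2)
      by (auto simp: pos_definite_def axis_eq_0_iff inner_axis' matrix_vector_mult_basis column_def dest!: spec[of _ "axis i 1"])
    have "Q' $ j $ k = 0" if "j \<noteq> k" "j \<notin> U \<or> k \<notin> U" for j k
      using that insert.prems(1)[of j k] insert.prems(1)[of j i] insert.prems(1)[of i k] \<open>0 < Q $ i $ i\<close>
      by (cases "j = i"; cases "k = i") (auto simp: Q'_def)
    with insert.IH[of Q'] elim(1,3) have IH: "0 < det Q"
      "(\<integral>\<^sup>+x. ennreal (exp (- quadratic_form Q' x / 2)) \<partial>lborel) = ennreal (sqrt ((2 * pi) ^ CARD('n) / det Q))"
      by auto
    have "(\<integral>\<^sup>+x. ennreal (exp (- quadratic_form Q x / 2)) \<partial>lborel)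
        = (\<integral>\<^sup>+x. ennreal (exp (- quadratic_form Q' (x + (r \<bullet> x) *\<^sub>R axis i 1) / 2)) \<partial>lborel)"
      by (simp add: elim(2))
    also have "\<dots> = (\<integral>\<^sup>+x. ennreal (exp (- quadratic_form Q' x / 2)) \<partial>lborel)"
      by (subst nn_integral_lborel_shear) (simp_all add: r_def)
    finally show ?case using IH by simp
  qed
  from this[of UNIV] show "0 < det Q"
    "(\<integral>\<^sup>+x. ennreal (exp (- quadratic_form Q x / 2)) \<partial>lborel) = ennreal (sqrt ((2 * pi) ^ CARD('n) / det Q))"
    by auto
qed

section \<open>The limiting quadratic form and covariance\<close>

abbreviation sqrt_diag :: "real^'m \<Rightarrow> real^'m^'m" where
  "sqrt_diag \<alpha> \<equiv> diag_matrix (\<chi> l. sqrt (\<alpha> $ l))"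

lemma diag_matrix_vector_mult: "(diag_matrix d *v x) $ i = d $ i * x $ i"
proof -
  have "(diag_matrix d *v x) $ i = (\<Sum>j\<in>UNIV. if i = j then d $ j * x $ j else 0)"
    unfolding matrix_vector_mult_def diag_matrix_def vec_lambda_beta by (rule sum.cong) auto
  then show ?thesis by simp
qed

lemma transpose_diag_matrix [simp]: "transpose (diag_matrix d) = diag_matrix d"
  by (auto simp: transpose_def diag_matrix_def vec_eq_iff)

lemma inner_diag_matrix: "x \<bullet> (diag_matrix d *v y) = (diag_matrix d *v x) \<bullet> y"
  by (simp add: symmetric_inner_matrix_vector inner_commute)

lemma sqrt_diag_mult_self:
  assumes "\<And>l. 0 \<le> \<alpha> $ l"
  shows "sqrt_diag \<alpha> ** sqrt_diag \<alpha> = diag_matrix \<alpha>"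
  by (simp add: matrix_eq diag_matrix_vector_mult vec_eq_iff assms mult.assoc[symmetric] flip: matrix_vector_mul_assoc)

lemma quadratic_form_conj_diag:
  "quadratic_form (diag_matrix d ** A ** diag_matrix d) x = quadratic_form A (diag_matrix d *v x)"
  by (simp add: quadratic_form_def inner_diag_matrix flip: matrix_vector_mul_assoc)

lemma matrix_inv_eqI:
  fixes A B :: "real^'m^'m"
  assumes "A ** B = mat 1"
  shows "matrix_inv A = B"
proof -
  have BA: "B ** A = mat 1" using assms by (simp add: matrix_left_right_inverse)
  have "A ** matrix_inv A = mat 1 \<and> matrix_inv A ** A = mat 1"
    unfolding matrix_inv_def by (rule someI[of _ B]) (use assms BA in simp)
  then have "matrix_inv A = (B ** A) ** matrix_inv A" by (simp add: BA)
  also have "\<dots> = B" using \<open>_ \<and> _\<close> by (simp flip: matrix_mul_assoc)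
  finally show ?thesis .
qed

text \<open>Invertibility comes from the positive determinant found by the elimination
  above.\<close>

lemma pos_definite_imp_invertible:
  fixes A :: "real^'m^'m"
  assumes "pos_definite A"
  shows "A ** matrix_inv A = mat 1" "matrix_inv A ** A = mat 1"
proof -
  have "invertible A"
    using nn_integral_gaussian(1)[OF assms] by (simp add: invertible_det_nz)
  then have "A ** matrix_inv A = mat 1 \<and> matrix_inv A ** A = mat 1"
    unfolding invertible_def matrix_inv_def by (rule someI_ex)
  then show "A ** matrix_inv A = mat 1" "matrix_inv A ** A = mat 1" by auto
qed

lemma matrix_add_rdistrib: "((A :: real^'n^'m) + B) ** C = A ** C + B ** C"
  by (simp add: matrix_matrix_mult_def vec_eq_iff distrib_right sum.distrib)

lemma matrix_sub_rdistrib: "((A :: real^'n^'m) - B) ** C = A ** C - B ** C"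
  by (simp add: matrix_matrix_mult_def vec_eq_iff left_diff_distrib sum_subtractf)

lemma matrix_sub_ldistrib: "(A :: real^'n^'m) ** (B - C) = A ** B - A ** C"
  by (simp add: matrix_matrix_mult_def vec_eq_iff right_diff_distrib sum_subtractf)

text \<open>
  The hypothesis is the resolvent identity of \<open>\<Sigma> = (J\<^sup>-\<^sup>1 - \<alpha>)\<^sup>-\<^sup>1\<close>, in a form that also makes sense
  for singular \<open>J\<close>.
\<close>

lemma limit_covariance_inverse:
  fixes J \<Sigma> :: "real^'m^'m"
  assumes "\<And>l. 0 \<le> \<alpha> $ l" and "\<Sigma> - \<Sigma> ** diag_matrix \<alpha> ** J = J"
  shows "(mat 1 + sqrt_diag \<alpha> ** \<Sigma> ** sqrt_diag \<alpha>) ** (mat 1 - sqrt_diag \<alpha> ** J ** sqrt_diag \<alpha>) = mat 1"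
proof -
  let ?s = "sqrt_diag \<alpha>"
  have "(mat 1 + ?s ** \<Sigma> ** ?s) ** (mat 1 - ?s ** J ** ?s)
      = mat 1 + ?s ** \<Sigma> ** ?s - ?s ** J ** ?s - ?s ** \<Sigma> ** (?s ** ?s) ** J ** ?s"
    by (simp add: matrix_add_rdistrib matrix_sub_ldistrib matrix_mul_assoc)
  \<comment> \<open>As \<open>?s\<close> squares to \<open>diag_matrix \<alpha>\<close>, the terms
    containing \<open>\<Sigma>\<close> combine into the left side of the hypothesis.\<close>
  also have "\<dots> = mat 1 + ?s ** (\<Sigma> - \<Sigma> ** diag_matrix \<alpha> ** J) ** ?s - ?s ** J ** ?s"
    using assms(1) by (simp add: sqrt_diag_mult_self matrix_sub_ldistrib matrix_sub_rdistrib matrix_mul_assoc)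
  also have "\<dots> = mat 1" by (simp add: assms(2))
  finally show ?thesis .
qed

section \<open>The two coupling regimes\<close>

text \<open>As \<open>\<alpha>\<close> sums to 1, the triple product of constant, diagonal and
  constant matrix just multiplies the constants, leaving the scalar identity
  \<open>\<gamma> - \<gamma> * \<beta> = \<beta>\<close> for
  \<open>\<gamma> = \<beta> / (1 - \<beta>)\<close>.\<close>

lemma homogeneous_resolvent:
  fixes \<alpha> :: "real^'m"
  assumes "(\<Sum>l\<in>UNIV. \<alpha> $ l) = 1" "\<beta> < 1"
  shows "const_matrix (\<beta> / (1 - \<beta>)) - const_matrix (\<beta> / (1 - \<beta>)) ** diag_matrix \<alpha> ** const_matrix \<beta>
    = (const_matrix \<beta> :: real^'m^'m)"
proof -
  have "(const_matrix \<gamma> ** diag_matrix \<alpha> ** const_matrix \<beta> :: real^'m^'m) = const_matrix (\<gamma> * \<beta>)" for \<gamma>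
  proof (subst matrix_eq, intro allI)
    fix x :: "real^'m"
    have const: "const_matrix c *v y = (\<chi> i. c * (\<Sum>j\<in>UNIV. y $ j))" for c and y :: "real^'m"
      by (simp add: matrix_vector_mult_def const_matrix_def sum_distrib_left)
    show "const_matrix \<gamma> ** diag_matrix \<alpha> ** const_matrix \<beta> *v x = const_matrix (\<gamma> * \<beta>) *v x"
      by (simp add: const diag_matrix_vector_mult assms(1) mult.assoc flip: matrix_vector_mul_assoc sum_distrib_right)
  qed
  moreover have "\<beta> / (1 - \<beta>) - \<beta> / (1 - \<beta>) * \<beta> = \<beta>"
  proof -
    have "\<beta> / (1 - \<beta>) - \<beta> / (1 - \<beta>) * \<beta> = \<beta> / (1 - \<beta>) * (1 - \<beta>)"
      by (simp add: right_diff_distrib)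
    then show ?thesis using assms(2) by simp
  qed
  ultimately show ?thesis
    by (simp add: const_matrix_def vec_eq_iff)
qed

text \<open>The form has rank at most one: it is \<open>\<beta> * (a \<bullet> x)\<^sup>2\<close>
  for the unit vector \<open>a\<close> of the roots of the \<open>\<alpha> $ l\<close>, so
  Cauchy-Schwarz and \<open>\<beta> < 1\<close> suffice.\<close>

lemma homogeneous_pos_definite:
  fixes \<alpha> :: "real^'m"
  assumes "\<And>l. 0 \<le> \<alpha> $ l" "(\<Sum>l\<in>UNIV. \<alpha> $ l) = 1" "0 \<le> \<beta>" "\<beta> < 1" "x \<noteq> 0"
  shows "quadratic_form (sqrt_diag \<alpha> ** const_matrix \<beta> ** sqrt_diag \<alpha>) x < x \<bullet> x"
proof -
  define a where "a = (\<chi> l. sqrt (\<alpha> $ l))"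
  have "quadratic_form (const_matrix \<beta>) y = \<beta> * (\<Sum>j\<in>UNIV. y $ j)\<^sup>2" for y :: "real^'m"
    by (simp add: quadratic_form_def inner_vec_def matrix_vector_mult_def const_matrix_def power2_eq_square
        sum_distrib_left sum_distrib_right mult_ac)
  then have "quadratic_form (sqrt_diag \<alpha> ** const_matrix \<beta> ** sqrt_diag \<alpha>) x = \<beta> * (a \<bullet> x)\<^sup>2"
    by (simp add: quadratic_form_conj_diag diag_matrix_vector_mult a_def inner_vec_def)
  also have "\<dots> \<le> \<beta> * ((a \<bullet> a) * (x \<bullet> x))"
    using assms(3) by (intro mult_left_mono Cauchy_Schwarz_ineq)
  also have "a \<bullet> a = 1"
    using assms(1,2) by (simp add: a_def inner_vec_def)
  also have "\<beta> * (1 * (x \<bullet> x)) < x \<bullet> x"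
    using assms(4,5) by simp
  finally show ?thesis .
qed

text \<open>Multiply \<open>\<Sigma> ** H_matrix J \<alpha> = mat 1\<close> by \<open>J\<close> on
  the right.\<close>

lemma heterogeneous_resolvent:
  fixes J :: "real^'m^'m"
  assumes "pos_definite J" "pos_definite (H_matrix J \<alpha>)"
  defines "\<Sigma> \<equiv> matrix_inv (H_matrix J \<alpha>)"
  shows "\<Sigma> - \<Sigma> ** diag_matrix \<alpha> ** J = J"
proof -
  have "J = (\<Sigma> ** H_matrix J \<alpha>) ** J"
    using pos_definite_imp_invertible[OF assms(2)] by (simp add: \<Sigma>_def)
  also have "\<dots> = \<Sigma> ** (matrix_inv J ** J) - \<Sigma> ** diag_matrix \<alpha> ** J"
    by (simp add: H_matrix_def matrix_sub_ldistrib matrix_sub_rdistrib matrix_mul_assoc)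
  finally show ?thesis
    using pos_definite_imp_invertible[OF assms(1)] by simp
qed

text \<open>The form equals \<open>x \<bullet> v\<close>. Positivity of
  \<open>H_matrix J \<alpha>\<close> at \<open>w\<close> says
  \<open>v \<bullet> v < x \<bullet> v\<close>, and
  \<open>2 * (x \<bullet> v) \<le> x \<bullet> x + v \<bullet> v\<close> then forces
  \<open>x \<bullet> v < x \<bullet> x\<close>. For \<open>w = 0\<close> the form vanishes.\<close>

lemma heterogeneous_pos_definite:
  fixes J :: "real^'m^'m"
  assumes "pos_definite J" "pos_definite (H_matrix J \<alpha>)" "\<And>l. 0 \<le> \<alpha> $ l" "x \<noteq> 0"
  shows "quadratic_form (sqrt_diag \<alpha> ** J ** sqrt_diag \<alpha>) x < x \<bullet> x"
proof -
  define y where "y = sqrt_diag \<alpha> *v x"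
  define w where "w = J *v y"
  define v where "v = sqrt_diag \<alpha> *v w"
  have y: "matrix_inv J *v w = y"
    by (simp add: w_def matrix_vector_mul_assoc pos_definite_imp_invertible[OF assms(1)])
  have eq: "quadratic_form (sqrt_diag \<alpha> ** J ** sqrt_diag \<alpha>) x = y \<bullet> w"
    by (simp add: quadratic_form_conj_diag) (simp add: quadratic_form_def y_def w_def)
  show ?thesis
  proof (cases "w = 0")
    case False
    then have "0 < w \<bullet> (H_matrix J \<alpha> *v w)"
      using assms(2) by (simp add: pos_definite_def)
    also have "H_matrix J \<alpha> *v w = y - sqrt_diag \<alpha> *v v"
      by (simp add: H_matrix_def matrix_vector_mult_diff_rdistrib y v_def matrix_vector_mul_assoc sqrt_diag_mult_self assms(3))
    also have "w \<bullet> (y - sqrt_diag \<alpha> *v v) = y \<bullet> w - v \<bullet> v"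
      by (simp add: inner_diff_right inner_diag_matrix inner_commute flip: v_def)
    finally have 1: "v \<bullet> v < y \<bullet> w" by simp
    have 2: "y \<bullet> w = x \<bullet> v"
      by (simp add: y_def v_def inner_diag_matrix)
    have "0 \<le> (x - v) \<bullet> (x - v)" by simp
    then have "2 * (x \<bullet> v) \<le> x \<bullet> x + v \<bullet> v"
      by (simp add: inner_diff_left inner_diff_right inner_commute)
    then show ?thesis using 1 2 eq by simp
  qed (use eq assms(4) in simp)
qed

section \<open>Uniform bounds on quadratic forms\<close>

text \<open>The form attains its maximum on the compact unit sphere, which makes the strict
  inequality uniform; homogeneity extends it to all vectors.\<close>

lemma quadratic_form_spectral_gap:
  fixes A :: "real^'m^'m"
  assumes "\<And>x. x \<noteq> 0 \<Longrightarrow> quadratic_form A x < x \<bullet> x"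
  obtains c where "0 \<le> c" "c < 1" "\<And>x. quadratic_form A x \<le> c * (x \<bullet> x)"
proof -
  have "axis undefined 1 \<in> sphere (0 :: real^'m) 1" by simp
  then have "\<exists>u\<in>sphere (0 :: real^'m) 1. \<forall>x\<in>sphere 0 1. quadratic_form A x \<le> quadratic_form A u"
    by (intro continuous_attains_sup continuous_intros) auto
  then obtain u where u: "norm u = 1" "\<And>x. norm x = 1 \<Longrightarrow> quadratic_form A x \<le> quadratic_form A u"
    by auto
  have scale: "quadratic_form A x \<le> quadratic_form A u * (x \<bullet> x)" for x
  proof (cases "x = 0")
    case False
    define y where "y = x /\<^sub>R norm x"
    have "x = norm x *\<^sub>R y" "norm y = 1" using False by (simp_all add: y_def)
    then have "quadratic_form A x = (norm x)\<^sup>2 * quadratic_form A y"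
      by (metis (no_types, lifting) inner_scaleR_left inner_scaleR_right matrix_vector_mult_scaleR mult.assoc
          power2_eq_square quadratic_form_def)
    then show ?thesis
      using u(2)[OF \<open>norm y = 1\<close>] by (simp add: mult_right_mono mult.commute flip: power2_norm_eq_inner)
  qed (simp add: quadratic_form_def)
  show thesis
  proof (rule that)
    \<comment> \<open>The maximum with 0 secures \<open>0 \<le> c\<close> when the form is negative
      on the whole sphere.\<close>
    show "max 0 (quadratic_form A u) < 1"
      using assms[of u] u(1) by (cases "u = 0") (auto simp flip: power2_norm_eq_inner)
    show "quadratic_form A x \<le> max 0 (quadratic_form A u) * (x \<bullet> x)" for x
      using scale[of x] by (meson inner_ge_zero max.cobounded2 mult_right_mono order_trans)
  qed simp
qed

lemma quadratic_form_le_sum_abs: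
  "quadratic_form A x \<le> (\<Sum>i\<in>UNIV. \<Sum>j\<in>UNIV. \<bar>A $ i $ j\<bar>) * (x \<bullet> x)"
proof -
  have "x $ i * (A $ i $ j * x $ j) \<le> \<bar>A $ i $ j\<bar> * (x \<bullet> x)" for i j
  proof -
    have "x $ i * (A $ i $ j * x $ j) \<le> \<bar>x $ i * (A $ i $ j * x $ j)\<bar>" by simp
    also have "\<dots> = \<bar>A $ i $ j\<bar> * (\<bar>x $ i\<bar> * \<bar>x $ j\<bar>)" by (simp add: abs_mult)
    also have "\<dots> \<le> \<bar>A $ i $ j\<bar> * (norm x * norm x)"
      by (intro mult_left_mono mult_mono component_le_norm_cart) auto
    finally show ?thesis by (simp add: power2_norm_eq_inner flip: power2_eq_square)
  qed
  then have "(\<Sum>i\<in>UNIV. \<Sum>j\<in>UNIV. x $ i * (A $ i $ j * x $ j)) \<le> (\<Sum>i\<in>UNIV. \<Sum>j\<in>UNIV. \<bar>A $ i $ j\<bar> * (x \<bullet> x))"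
    by (intro sum_mono)
  moreover have "quadratic_form A x = (\<Sum>i\<in>UNIV. \<Sum>j\<in>UNIV. x $ i * (A $ i $ j * x $ j))"
    by (simp add: quadratic_form_def inner_vec_def matrix_vector_mult_def sum_distrib_left)
  ultimately show ?thesis
    by (simp add: sum_distrib_right)
qed

text \<open>The form of \<open>A' n - A\<close> is at most its absolute entry sum times
  \<open>x \<bullet> x\<close>, so the gap \<open>d - c\<close> absorbs it for all \<open>x\<close>
  at once.\<close>

lemma eventually_quadratic_form_le:
  fixes A :: "real^'m^'m" and A' :: "nat \<Rightarrow> real^'m^'m"
  assumes lim: "A' \<longlonglongrightarrow> A" and "c < d" "\<And>x. quadratic_form A x \<le> c * (x \<bullet> x)"
  shows "\<forall>\<^sub>F n in sequentially. \<forall>x. quadratic_form (A' n) x \<le> d * (x \<bullet> x)"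
proof -
  have "(\<lambda>n. \<Sum>i\<in>UNIV. \<Sum>j\<in>UNIV. \<bar>(A' n - A) $ i $ j\<bar>) \<longlonglongrightarrow> (\<Sum>i\<in>UNIV. \<Sum>j\<in>UNIV. \<bar>(A - A) $ i $ j\<bar>)"
    by (intro tendsto_intros lim)
  then have "(\<lambda>n. \<Sum>i\<in>UNIV. \<Sum>j\<in>UNIV. \<bar>(A' n - A) $ i $ j\<bar>) \<longlonglongrightarrow> 0"
    by simp
  from order_tendstoD(2)[OF this, of "d - c"] \<open>c < d\<close>
  have "\<forall>\<^sub>F n in sequentially. (\<Sum>i\<in>UNIV. \<Sum>j\<in>UNIV. \<bar>(A' n - A) $ i $ j\<bar>) < d - c" by simp
  then show ?thesis
  proof (eventually_elim, intro allI)
    fix n x assume *: "(\<Sum>i\<in>UNIV. \<Sum>j\<in>UNIV. \<bar>(A' n - A) $ i $ j\<bar>) < d - c"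
    have "quadratic_form (A' n) x = quadratic_form A x + quadratic_form (A' n - A) x"
      by (simp add: quadratic_form_def matrix_vector_mult_diff_rdistrib inner_diff_right)
    also have "\<dots> \<le> c * (x \<bullet> x) + (d - c) * (x \<bullet> x)"
      using * by (intro add_mono assms order_trans[OF quadratic_form_le_sum_abs] mult_right_mono) auto
    finally show "quadratic_form (A' n) x \<le> d * (x \<bullet> x)"
      by (simp add: algebra_simps)
  qed
qed

section \<open>The model as a tilt of independent spins\<close>

context curie_weiss
begin

text \<open>Restriction to the sites places every sample in the finite set
  \<open>spin_configs gs\<close>.\<close>

definition spin_config :: "'a \<Rightarrow> 'm \<times> nat \<Rightarrow> real" where
  "spin_config \<omega> = (\<lambda>(l, i)\<in>spin_sites gs. X l i \<omega>)"

lemma spin_config_in_spin_configs: "\<omega> \<in> space P \<Longrightarrow> spin_config \<omega> \<in> spin_configs gs"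
  using spin_values by (fastforce simp: spin_config_def spin_configs_def spin_sites_def)

lemma spin_config_eq_iff:
  assumes "x \<in> spin_configs gs"
  shows "spin_config \<omega> = x \<longleftrightarrow> (\<forall>l. \<forall>i\<in>{1..gs l}. X l i \<omega> = x (l, i))"
proof
  assume "spin_config \<omega> = x"
  then show "\<forall>l. \<forall>i\<in>{1..gs l}. X l i \<omega> = x (l, i)"
    by (auto simp: spin_config_def spin_sites_def)
next
  assume "\<forall>l. \<forall>i\<in>{1..gs l}. X l i \<omega> = x (l, i)"
  with assms show "spin_config \<omega> = x"
    by (auto simp: fun_eq_iff spin_config_def spin_sites_def spin_configs_def PiE_def extensional_def)
qed

lemma finite_spin_configs: "finite (spin_configs gs)"
  unfolding spin_configs_def spin_sites_def by (intro finite_PiE finite_SigmaI) auto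

text \<open>The events of the law assumption partition the space, one for each configuration, so an
  expectation is a finite sum.\<close>

lemma expectation_spin_config:
  fixes G :: "('m \<times> nat \<Rightarrow> real) \<Rightarrow> real"
  shows "expectation (\<lambda>\<omega>. G (spin_config \<omega>))
    = (\<Sum>x\<in>spin_configs gs. G x * (cw_weight J gs x / cw_partition J gs))"
proof -
  define E where "E x = {\<omega> \<in> space P. \<forall>l. \<forall>i\<in>{1..gs l}. X l i \<omega> = x (l, i)}" for x
  note spin_measurable[measurable]
  have E_sets: "E x \<in> events" for x
  proof -
    have "E x = {\<omega> \<in> space P. \<forall>l\<in>UNIV. \<forall>i\<in>{1..gs l}. X l i \<omega> \<in> {x (l, i)}}"
      by (auto simp: E_def)
    also have "\<dots> \<in> events"
      by (intro sets.sets_Collect_finite_All' sets.sets_Collect_finite_All) auto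
    finally show ?thesis .
  qed
  have "expectation (\<lambda>\<omega>. G (spin_config \<omega>)) = expectation (\<lambda>\<omega>. \<Sum>x\<in>spin_configs gs. G x * indicator (E x) \<omega>)"
  proof (rule Bochner_Integration.integral_cong[OF refl])
    fix \<omega> assume \<omega>: "\<omega> \<in> space P"
    have "(\<Sum>x\<in>spin_configs gs. G x * indicator (E x) \<omega>)
        = (\<Sum>x\<in>spin_configs gs. if x = spin_config \<omega> then G x else 0)"
    proof (intro sum.cong refl)
      fix x assume "x \<in> spin_configs gs"
      then have "\<omega> \<in> E x \<longleftrightarrow> x = spin_config \<omega>"
        using \<omega> spin_config_eq_iff[of x \<omega>] by (auto simp: E_def)
      then show "G x * indicator (E x) \<omega> = (if x = spin_config \<omega> then G x else 0)"
        by (simp add: indicator_def)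
    qed
    also have "\<dots> = G (spin_config \<omega>)"
      using spin_config_in_spin_configs[OF \<omega>] finite_spin_configs by simp
    finally show "G (spin_config \<omega>) = (\<Sum>x\<in>spin_configs gs. G x * indicator (E x) \<omega>)" ..
  qed
  also have "\<dots> = (\<Sum>x\<in>spin_configs gs. G x * prob (E x))"
    using E_sets by (simp add: Bochner_Integration.integral_sum emeasure_eq_measure)
  also have "\<dots> = (\<Sum>x\<in>spin_configs gs. G x * (cw_weight J gs x / cw_partition J gs))"
    by (intro sum.cong refl) (simp add: E_def spin_law del: One_nat_def)
  finally show ?thesis .
qed

end

section \<open>The Gibbs weight as an exponential quadratic form, and the free spins\<close>

definition config_sums :: "('m \<Rightarrow> nat) \<Rightarrow> ('m \<times> nat \<Rightarrow> real) \<Rightarrow> real^'m" where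
  "config_sums gs x = (\<chi> l. (\<Sum>i=1..gs l. x (l, i)) / sqrt (real (gs l)))"

definition rescaled_coupling :: "real^'m^'m \<Rightarrow> ('m \<Rightarrow> nat) \<Rightarrow> real^'m^'m" where
  "rescaled_coupling J gs =
     sqrt_diag (\<chi> l. real (gs l) / real (\<Sum>l\<in>UNIV. gs l)) ** J ** sqrt_diag (\<chi> l. real (gs l) / real (\<Sum>l\<in>UNIV. gs l))"

lemma (in curie_weiss) normalized_spin_sums_eq:
  "normalized_spin_sums gs X \<omega> = config_sums gs (spin_config \<omega>)"
  by (auto simp: normalized_spin_sums_def config_sums_def spin_config_def spin_sites_def vec_eq_iff intro!: sum.cong)

lemma cw_weight_eq_exp_quadratic_form:
  "cw_weight J gs x = exp (quadratic_form (rescaled_coupling J gs) (config_sums gs x) / 2)"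
proof -
  define N where "N = (\<Sum>l\<in>UNIV. gs l)"
  define S where "S l = (\<Sum>i=1..gs l. x (l, i))" for l
  define w where "w = sqrt_diag (\<chi> l. real (gs l) / real N) *v config_sums gs x"
  have w: "w $ l = S l / sqrt (real N)" for l
    \<comment> \<open>For an empty group both sides are 0; otherwise the root of \<open>gs l\<close>
      cancels.\<close>
    by (cases "gs l = 0") (auto simp: w_def diag_matrix_vector_mult config_sums_def S_def real_sqrt_divide)
  have "quadratic_form (rescaled_coupling J gs) (config_sums gs x)
      = (\<Sum>l\<in>UNIV. \<Sum>m\<in>UNIV. S l / sqrt (real N) * (J $ l $ m * (S m / sqrt (real N))))"
    unfolding rescaled_coupling_def quadratic_form_conj_diag N_def[symmetric] w_def[symmetric]
    by (simp add: quadratic_form_def inner_vec_def matrix_vector_mult_def w sum_distrib_left)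
  also have "\<dots> = (\<Sum>l\<in>UNIV. \<Sum>m\<in>UNIV. J $ l $ m * (S l * S m) / real N)"
    by (intro sum.cong refl) simp
  also have "\<dots> = (\<Sum>l\<in>UNIV. \<Sum>m\<in>UNIV. J $ l $ m * (S l * S m)) / real N"
    by (simp add: sum_divide_distrib)
  finally show ?thesis
    by (simp add: cw_weight_def S_def sum_product flip: N_def)
qed

text \<open>Spins are numbered from 1 and flips from 0, hence the shift.\<close>

definition free_spin :: "'m \<Rightarrow> nat \<Rightarrow> ('m \<Rightarrow> nat \<Rightarrow> bool) \<Rightarrow> real" where
  "free_spin l i \<omega> = flip_sign (\<omega> l (i - 1))"

abbreviation free_space :: "('m \<Rightarrow> nat \<Rightarrow> bool) measure" where
  "free_space \<equiv> \<Pi>\<^sub>M l\<in>UNIV. coin_flips"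

lemma cw_partition_zero: "cw_partition 0 gs = 2 ^ (\<Sum>l\<in>UNIV. gs l)"
proof -
  have "card (spin_configs gs) = 2 ^ (\<Sum>l\<in>UNIV. gs l)"
    unfolding spin_configs_def spin_sites_def
    by (subst card_PiE) (auto intro!: finite_SigmaI simp: card_SigmaI numeral_2_eq_2)
  then show ?thesis by (simp add: cw_partition_def cw_weight_def)
qed

lemma emeasure_coin_flips_cylinder:
  assumes "\<And>i. i < k \<Longrightarrow> s i \<in> {-1, 1}"
  shows "emeasure coin_flips {\<omega>\<in>space coin_flips. \<forall>i\<in>{..<k}. \<omega> i \<in> {b. flip_sign b = s i}} = ennreal ((1 / 2) ^ k)"
proof -
  interpret product_prob_space "\<lambda>_::nat. measure_pmf (bernoulli_pmf (1 / 2))" UNIV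
    by unfold_locales
  have "emeasure (measure_pmf (bernoulli_pmf (1 / 2))) {b. flip_sign b = s i} = ennreal (1 / 2)" if "i < k" for i
  proof -
    \<comment> \<open>The right side is a singleton whose element is the truth value of
      \<open>s i = 1\<close>.\<close>
    have "{b. flip_sign b = s i} = {s i = 1}"
      using assms[OF that] by (auto simp: flip_sign_def split: if_splits)
    then show ?thesis by (cases "s i = 1") (simp_all add: emeasure_pmf_single)
  qed
  then show ?thesis
    unfolding coin_flips_def by (subst emeasure_PiM_Collect) (simp_all add: ennreal_power del: ennreal_half)
qed

text \<open>Independent fair spins form the model with zero coupling, so the same expectation
  formula serves both sides of the comparison.\<close>

lemma curie_weiss_free: "curie_weiss (free_space :: ('m::finite \<Rightarrow> _) measure) 0 gs free_spin"
proof -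
  interpret product_prob_space "\<lambda>_::'m. coin_flips" UNIV ..
  show ?thesis
  proof
    show "free_spin l i \<in> borel_measurable free_space" for l :: 'm and i
      unfolding free_spin_def
      by (rule measurable_compose[OF measurable_component_singleton[of l UNIV "\<lambda>_. coin_flips"]
            measurable_coin_flips(2)[of "i - 1"]]) simp
    show "free_spin l i \<omega> \<in> {-1, 1}" for l :: 'm and i \<omega>
      by (simp add: free_spin_def flip_sign_def)
    fix x :: "'m \<times> nat \<Rightarrow> real" assume x: "x \<in> spin_configs gs"
    define B where "B l = {\<omega>\<in>space coin_flips. \<forall>i\<in>{..<gs l}. \<omega> i \<in> {b. flip_sign b = x (l, Suc i)}}" for l
    have B: "emeasure coin_flips (B l) = ennreal ((1 / 2) ^ gs l)" for l
      unfolding B_def using x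
      by (intro emeasure_coin_flips_cylinder) (auto simp: spin_configs_def spin_sites_def)
    have "{\<omega> \<in> space free_space. \<forall>l. \<forall>i\<in>{1..gs l}. free_spin l i \<omega> = x (l, i)}
        = {\<omega> \<in> space free_space. \<forall>l\<in>UNIV. \<omega> l \<in> B l}"
    proof -
      have "(\<forall>i\<in>{1..n}. Q i) \<longleftrightarrow> (\<forall>i\<in>{..<n}. Q (Suc i))" for n and Q :: "nat \<Rightarrow> bool"
        by (metis One_nat_def atLeastAtMost_iff image_Suc_lessThan image_iff imageI)
      then show ?thesis
        by (auto simp: B_def free_spin_def space_PiM PiE_iff)
    qed
    also have "emeasure free_space \<dots> = (\<Prod>l\<in>UNIV. emeasure coin_flips (B l))"
      by (rule emeasure_PiM_Collect) (auto simp: B_def)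
    also have "\<dots> = ennreal (1 / 2 ^ (\<Sum>l\<in>UNIV. gs l))"
      by (simp add: B prod_ennreal power_one_over prod_dividef power_sum)
    finally show "measure free_space {\<omega> \<in> space free_space. \<forall>l. \<forall>i\<in>{1..gs l}. free_spin l i \<omega> = x (l, i)}
        = cw_weight 0 gs x / cw_partition 0 gs"
      by (simp add: cw_partition_zero measure_def cw_weight_def)
  qed
qed

lemma normalized_spin_sums_free:
  "normalized_spin_sums gs free_spin \<omega> = (\<chi> l. normalized_walk (gs l) (\<omega> l))"
  by (simp add: normalized_spin_sums_def free_spin_def normalized_walk_def vec_eq_iff sum.atLeast1_atMost_eq)

text \<open>Both free integrals are sums over configurations divided by the same
  \<open>cw_partition 0 gs\<close>, which cancels; the remaining denominator is the partition
  function of \<open>J\<close>.\<close>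

lemma (in curie_weiss) expectation_eq_tilted_free:
  fixes f :: "real^'m \<Rightarrow> real"
  defines "V \<equiv> \<lambda>\<omega>. \<chi> l. normalized_walk (gs l) (\<omega> l)"
  defines "A \<equiv> rescaled_coupling J gs"
  shows "expectation (\<lambda>\<omega>. f (normalized_spin_sums gs X \<omega>))
    = (\<integral>\<omega>. f (V \<omega>) * exp (quadratic_form A (V \<omega>) / 2) \<partial>free_space) / (\<integral>\<omega>. exp (quadratic_form A (V \<omega>) / 2) \<partial>free_space)"
proof -
  interpret free: curie_weiss free_space 0 gs free_spin
    by (rule curie_weiss_free)
  have free: "(\<integral>\<omega>. g (V \<omega>) \<partial>free_space) = (\<Sum>x\<in>spin_configs gs. g (config_sums gs x)) / cw_partition 0 gs"
    for g :: "real^'m \<Rightarrow> real"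
    using free.expectation_spin_config[of "\<lambda>x. g (config_sums gs x)"]
    by (simp add: V_def cw_weight_def sum_divide_distrib
        flip: normalized_spin_sums_free free.normalized_spin_sums_eq)
  have "cw_partition 0 gs \<noteq> 0" by (simp add: cw_partition_zero)
  moreover have "expectation (\<lambda>\<omega>. f (normalized_spin_sums gs X \<omega>))
      = (\<Sum>x\<in>spin_configs gs. f (config_sums gs x) * cw_weight J gs x) / cw_partition J gs"
    by (simp add: normalized_spin_sums_eq expectation_spin_config[of "\<lambda>x. f (config_sums gs x)"] sum_divide_distrib)
  ultimately show ?thesis
    unfolding free[of "\<lambda>v. f v * exp (quadratic_form A v / 2)"] free[of "\<lambda>v. exp (quadratic_form A v / 2)"]
    by (simp add: cw_weight_eq_exp_quadratic_form A_def cw_partition_def[of J])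
qed

section \<open>Convergence of the tilted expectations\<close>

lemma borel_measurable_PiM_component:
  "\<phi> \<in> borel_measurable M \<Longrightarrow> (\<lambda>\<omega>. \<phi> (\<omega> l)) \<in> borel_measurable (\<Pi>\<^sub>M l\<in>UNIV. M)"
  by (rule measurable_compose[OF measurable_component_singleton[of l UNIV "\<lambda>_. M"]]) simp_all

text \<open>Rectangles determine a product measure, and the preimage of a rectangle under a
  coordinatewise map is again a rectangle.\<close>

lemma distr_PiM_coordinatewise:
  fixes \<phi> :: "'i::finite \<Rightarrow> 'a \<Rightarrow> real"
  assumes M: "prob_space M" and \<phi>: "\<And>l. \<phi> l \<in> borel_measurable M"
  shows "distr (\<Pi>\<^sub>M l\<in>UNIV. M) (\<Pi>\<^sub>M l\<in>UNIV. borel) (\<lambda>\<omega> l. \<phi> l (\<omega> l)) = (\<Pi>\<^sub>M l\<in>UNIV. distr M borel (\<phi> l))"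
proof -
  interpret prob_space M by fact
  interpret M: product_prob_space "\<lambda>_::'i. M" UNIV ..
  interpret D: product_prob_space "\<lambda>l. distr M borel (\<phi> l)" UNIV
    by (intro product_prob_spaceI prob_space_distr \<phi>)
  have meas: "(\<lambda>\<omega> l. \<phi> l (\<omega> l)) \<in> (\<Pi>\<^sub>M l\<in>UNIV. M) \<rightarrow>\<^sub>M (\<Pi>\<^sub>M l\<in>UNIV. borel)"
    by (intro measurable_PiM_single' borel_measurable_PiM_component \<phi>) auto
  show ?thesis
  proof (rule D.PiM_eqI)
    fix A assume "\<And>l. l \<in> UNIV \<Longrightarrow> A l \<in> sets (distr M borel (\<phi> l))"
    then have A: "A l \<in> sets borel" for l by simp
    have "emeasure (distr (\<Pi>\<^sub>M l\<in>UNIV. M) (\<Pi>\<^sub>M l\<in>UNIV. borel) (\<lambda>\<omega> l. \<phi> l (\<omega> l))) (\<Pi>\<^sub>E l\<in>UNIV. A l)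
        = emeasure (\<Pi>\<^sub>M l\<in>UNIV. M) (\<Pi>\<^sub>E l\<in>UNIV. \<phi> l -` A l \<inter> space M)"
      using A by (subst emeasure_distr[OF meas])
        (auto simp: space_PiM PiE_iff intro!: arg_cong[where f = "emeasure _"] sets_PiM_I_finite)
    also have "\<dots> = (\<Prod>l\<in>UNIV. emeasure (distr M borel (\<phi> l)) (A l))"
      using A \<phi> by (subst M.emeasure_PiM) (auto simp: emeasure_distr measurable_sets)
    finally show "emeasure (distr (\<Pi>\<^sub>M l\<in>UNIV. M) (\<Pi>\<^sub>M l\<in>UNIV. borel) (\<lambda>\<omega> l. \<phi> l (\<omega> l))) (\<Pi>\<^sub>E l\<in>UNIV. A l)
        = (\<Prod>l\<in>UNIV. emeasure (distr M borel (\<phi> l)) (A l))" .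
  qed (simp_all cong: sets_PiM_cong)
qed

text \<open>The right side depends only on the marginal laws, so coin flips may be exchanged for the
  Skorohod space.\<close>

lemma integral_PiM_coordinatewise:
  fixes \<phi> :: "'i::finite \<Rightarrow> 'a \<Rightarrow> real" and g :: "real^'i \<Rightarrow> real"
  assumes M: "prob_space M" and \<phi>: "\<And>l. \<phi> l \<in> borel_measurable M" and [measurable]: "g \<in> borel_measurable borel"
  shows "(\<integral>\<omega>. g (\<chi> l. \<phi> l (\<omega> l)) \<partial>(\<Pi>\<^sub>M l\<in>UNIV. M)) = (\<integral>x. g (vec_lambda x) \<partial>(\<Pi>\<^sub>M l\<in>UNIV. distr M borel (\<phi> l)))"
proof -
  have meas: "(\<lambda>\<omega> l. \<phi> l (\<omega> l)) \<in> (\<Pi>\<^sub>M l\<in>UNIV. M) \<rightarrow>\<^sub>M (\<Pi>\<^sub>M l\<in>UNIV. borel)"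
    by (intro measurable_PiM_single' borel_measurable_PiM_component \<phi>) auto
  show ?thesis
    unfolding distr_PiM_coordinatewise[OF M \<phi>, symmetric]
    by (subst integral_distr[OF meas]) simp_all
qed

lemma PiM_std_normal:
  "(\<Pi>\<^sub>M l\<in>(UNIV :: 'i::finite set). std_normal_distribution)
    = density (\<Pi>\<^sub>M l\<in>UNIV. lborel) (\<lambda>x. \<Prod>l\<in>UNIV. ennreal (std_normal_density (x l)))"
proof -
  interpret L: product_sigma_finite "\<lambda>_::'i. lborel :: real measure" ..
  interpret N: prob_space std_normal_distribution by (rule prob_space_normal_density) simp
  interpret D: product_prob_space "\<lambda>_::'i. std_normal_distribution" UNIV ..
  show ?thesis
  proof (rule D.PiM_eqI[symmetric])
    fix A :: "'i \<Rightarrow> real set" assume "\<And>l. l \<in> UNIV \<Longrightarrow> A l \<in> sets std_normal_distribution"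
    then have A: "A l \<in> sets borel" for l by simp
    have "emeasure (density (\<Pi>\<^sub>M l\<in>UNIV. lborel) (\<lambda>x. \<Prod>l\<in>UNIV. ennreal (std_normal_density (x l)))) (\<Pi>\<^sub>E l\<in>UNIV. A l)
        = (\<integral>\<^sup>+x. (\<Prod>l\<in>UNIV. ennreal (std_normal_density (x l))) * indicator (\<Pi>\<^sub>E l\<in>UNIV. A l) x \<partial>(\<Pi>\<^sub>M l\<in>UNIV. lborel))"
      using A by (intro emeasure_density) (auto intro!: sets_PiM_I_finite)
    also have "\<dots> = (\<integral>\<^sup>+x. (\<Prod>l\<in>UNIV. ennreal (std_normal_density (x l)) * indicator (A l) (x l)) \<partial>(\<Pi>\<^sub>M l\<in>UNIV. lborel))"
    proof -
      have "indicator (\<Pi>\<^sub>E l\<in>UNIV. A l) x = (\<Prod>l\<in>UNIV. indicator (A l) (x l) :: ennreal)" for x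
        by (cases "x \<in> (\<Pi>\<^sub>E l\<in>UNIV. A l)") (auto simp: PiE_iff indicator_def)
      then show ?thesis by (simp add: prod.distrib)
    qed
    also have "\<dots> = (\<Prod>l\<in>UNIV. emeasure std_normal_distribution (A l))"
      using A by (subst L.product_nn_integral_prod) (auto simp: emeasure_density)
    finally show "emeasure (density (\<Pi>\<^sub>M l\<in>UNIV. lborel) (\<lambda>x. \<Prod>l\<in>UNIV. ennreal (std_normal_density (x l)))) (\<Pi>\<^sub>E l\<in>UNIV. A l)
        = (\<Prod>l\<in>UNIV. emeasure std_normal_distribution (A l))" .
  qed (simp_all cong: sets_PiM_cong)
qed

lemma integral_PiM_std_normal:
  fixes g :: "real^'i \<Rightarrow> real"
  assumes [measurable]: "g \<in> borel_measurable borel"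
  shows "(\<integral>x. g (vec_lambda x) \<partial>(\<Pi>\<^sub>M l\<in>UNIV. std_normal_distribution))
    = (1 / sqrt (2 * pi)) ^ CARD('i) * (\<integral>z. g z * exp (- (z \<bullet> z) / 2) \<partial>lborel)"
proof -
  have dens: "(\<Prod>l\<in>UNIV. std_normal_density (z $ l)) = (1 / sqrt (2 * pi)) ^ CARD('i) * exp (- (z \<bullet> z) / 2)" for z :: "real^'i"
    by (simp add: std_normal_density_def prod.distrib inner_vec_def sum_negf sum_divide_distrib power2_eq_square prod_dividef
        power_one_over flip: exp_sum)
  have "(\<integral>x. g (vec_lambda x) \<partial>(\<Pi>\<^sub>M l\<in>UNIV. std_normal_distribution))
      = (\<integral>x. (\<Prod>l\<in>UNIV. std_normal_density (vec_lambda x $ l)) * g (vec_lambda x) \<partial>(\<Pi>\<^sub>M l\<in>UNIV. lborel))"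
    unfolding PiM_std_normal by (subst integral_real_density[symmetric]) (simp_all add: prod_ennreal prod_nonneg)
  also have "\<dots> = (\<integral>z. (\<Prod>l\<in>UNIV. std_normal_density (z $ l)) * g z \<partial>lborel)"
    by (subst lborel_eq_distr_PiM_vec_lambda, subst integral_distr) simp_all
  also have "\<dots> = (1 / sqrt (2 * pi)) ^ CARD('i) * (\<integral>z. g z * exp (- (z \<bullet> z) / 2) \<partial>lborel)"
    unfolding dens by (subst integral_mult_right_zero[symmetric]) (simp add: mult_ac)
  finally show ?thesis .
qed

text \<open>The exponential of a sum of squares is a product over the coordinates, so the integral
  factorises.\<close>

lemma nn_integral_PiM_exp_square_le:
  fixes \<phi> :: "'i::finite \<Rightarrow> 'a \<Rightarrow> real"
  assumes M: "prob_space M" and \<phi>: "\<And>l. \<phi> l \<in> borel_measurable M"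
    and le: "\<And>l. (\<integral>\<^sup>+x. ennreal (exp (c / 2 * (\<phi> l x)\<^sup>2)) \<partial>M) \<le> ennreal B" and "0 \<le> B"
  defines "V \<equiv> \<lambda>\<omega>. (\<chi> l. \<phi> l (\<omega> l))"
  shows "(\<integral>\<^sup>+\<omega>. ennreal (exp (c / 2 * (V \<omega> \<bullet> V \<omega>))) \<partial>(\<Pi>\<^sub>M l\<in>UNIV. M)) \<le> ennreal (B ^ CARD('i))"
proof -
  interpret prob_space M by fact
  interpret M: product_prob_space "\<lambda>_::'i. M" UNIV ..
  have "(\<integral>\<^sup>+\<omega>. ennreal (exp (c / 2 * (V \<omega> \<bullet> V \<omega>))) \<partial>(\<Pi>\<^sub>M l\<in>UNIV. M))
      = (\<integral>\<^sup>+\<omega>. (\<Prod>l\<in>UNIV. ennreal (exp (c / 2 * (\<phi> l (\<omega> l))\<^sup>2))) \<partial>(\<Pi>\<^sub>M l\<in>UNIV. M))"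
    by (simp add: V_def prod_ennreal inner_vec_def sum_distrib_left power2_eq_square flip: exp_sum)
  also have "\<dots> = (\<Prod>l\<in>UNIV. \<integral>\<^sup>+x. ennreal (exp (c / 2 * (\<phi> l x)\<^sup>2)) \<partial>M)"
    using \<phi> by (intro M.product_nn_integral_prod) auto
  also have "\<dots> \<le> (\<Prod>l\<in>(UNIV :: 'i set). ennreal B)"
    by (intro prod_mono_ennreal le)
  also have "\<dots> = ennreal (B ^ CARD('i))"
    using \<open>0 \<le> B\<close> by (simp add: ennreal_power)
  finally show ?thesis .
qed

text \<open>On the product of Skorohod spaces the tilted integrands converge pointwise, and a moment
  of order above 1 stays bounded; the Gaussian density of the limit then absorbs the tilt.\<close>

proposition tilted_walk_limit:
  fixes k :: "nat \<Rightarrow> 'm::finite \<Rightarrow> nat" and A' :: "nat \<Rightarrow> real^'m^'m" and f :: "real^'m \<Rightarrow> real"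
  assumes k: "\<And>l. filterlim (\<lambda>n. k n l) at_top sequentially"
    and A': "A' \<longlonglongrightarrow> A"
    and A: "\<And>x. x \<noteq> 0 \<Longrightarrow> quadratic_form A x < x \<bullet> x"
    and f: "continuous_on UNIV f" "bounded (range f)"
  defines "V \<equiv> \<lambda>n \<omega>. \<chi> l. normalized_walk (k n l) (\<omega> l)"
  shows "(\<lambda>n. \<integral>\<omega>. f (V n \<omega>) * exp (quadratic_form (A' n) (V n \<omega>) / 2) \<partial>free_space) \<longlonglongrightarrow>
    (1 / sqrt (2 * pi)) ^ CARD('m) * (\<integral>z. f z * exp (- quadratic_form (mat 1 - A) z / 2) \<partial>lborel)"
proof -
  obtain \<Omega> :: "real measure" and Y Z where \<Omega>: "prob_space \<Omega>" and meas: "\<And>k. Y k \<in> borel_measurable \<Omega>" "Z \<in> borel_measurable \<Omega>"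
    and Y: "\<And>k. distr \<Omega> borel (Y k) = distr coin_flips borel (normalized_walk k)"
    and Z: "distr \<Omega> borel Z = std_normal_distribution"
    and lim: "\<And>x. x \<in> space \<Omega> \<Longrightarrow> (\<lambda>k. Y k x) \<longlonglongrightarrow> Z x"
    by (rule normalized_walk_Skorohod) (rule that)
  interpret \<Omega>: prob_space \<Omega> by fact
  interpret \<Omega>m: product_prob_space "\<lambda>_::'m. \<Omega>" UNIV ..
  obtain c where c: "0 \<le> c" "c < 1" "\<And>x. quadratic_form A x \<le> c * (x \<bullet> x)"
    using quadratic_form_spectral_gap[OF A] by blast
  \<comment> \<open>With \<open>c < d < e < 1\<close>, the gap up to \<open>d\<close> absorbs the
    error of \<open>A' n\<close>, and the gap up to \<open>e\<close> leaves room for a power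
    \<open>p > 1\<close> with \<open>p * d = e\<close>, still below the critical value 1.\<close>
  define d where "d = (c + 1) / 2"
  define e where "e = (d + 1) / 2"
  define p where "p = e / d"
  have de: "c < d" "0 < d" "0 \<le> e" "e < 1" "1 < p" "p * d = e"
    using c by (auto simp: d_def e_def p_def field_simps)
  obtain K where K: "0 < K" "\<And>x. \<bar>f x\<bar> \<le> K"
    using f(2) by (auto simp: bounded_pos)
  note f_meas[measurable] = borel_measurable_continuous_onI[OF f(1)]
  define W where "W n \<omega> = (\<chi> l. Y (k n l) (\<omega> l))" for n \<omega>
  define U where "U \<omega> = (\<chi> l. Z (\<omega> l))" for \<omega> :: "'m \<Rightarrow> real"
  have W_meas[measurable]: "W n \<in> borel_measurable (\<Pi>\<^sub>M l\<in>UNIV. \<Omega>)" for n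
    unfolding W_def by (intro measurable_vec_lambda borel_measurable_PiM_component meas)
  have U_meas[measurable]: "U \<in> borel_measurable (\<Pi>\<^sub>M l\<in>UNIV. \<Omega>)"
    unfolding U_def by (intro measurable_vec_lambda borel_measurable_PiM_component meas)
  define g where "g n v = f v * exp (quadratic_form (A' n) v / 2)" for n v
  have g_meas[measurable]: "g n \<in> borel_measurable borel" for n
    unfolding g_def by measurable
  have "(\<integral>\<omega>. g n (V n \<omega>) \<partial>free_space) = (\<integral>\<omega>. g n (W n \<omega>) \<partial>(\<Pi>\<^sub>M l\<in>UNIV. \<Omega>))" for n
    unfolding V_def W_def
    by (subst (1 2) integral_PiM_coordinatewise) (simp_all add: \<Omega> prob_space_coin_flips meas Y)
  moreover have "(\<lambda>n. \<integral>\<omega>. g n (W n \<omega>) \<partial>(\<Pi>\<^sub>M l\<in>UNIV. \<Omega>)) \<longlonglongrightarrow>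
      (\<integral>\<omega>. f (U \<omega>) * exp (quadratic_form A (U \<omega>) / 2) \<partial>(\<Pi>\<^sub>M l\<in>UNIV. \<Omega>))"
  proof (rule \<Omega>m.tendsto_integral_of_moment_bound)
    fix \<omega> assume "\<omega> \<in> space (\<Pi>\<^sub>M l\<in>(UNIV :: 'm set). \<Omega>)"
    then have "\<omega> l \<in> space \<Omega>" for l by (simp add: space_PiM PiE_iff)
    then have W_lim: "(\<lambda>n. W n \<omega>) \<longlonglongrightarrow> U \<omega>"
      unfolding W_def U_def by (intro tendsto_vec_lambda filterlim_compose[OF lim k])
    have "(\<lambda>n. f (W n \<omega>)) \<longlonglongrightarrow> f (U \<omega>)"
      using f(1) W_lim by (intro isCont_tendsto_compose[where g = f]) (auto simp: continuous_on_eq_continuous_at)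
    moreover have "(\<lambda>n. quadratic_form (A' n) (W n \<omega>)) \<longlonglongrightarrow> quadratic_form A (U \<omega>)"
      unfolding quadratic_form_def matrix_vector_mult_def by (intro tendsto_intros tendsto_vec_lambda A' W_lim)
    ultimately show "(\<lambda>n. g n (W n \<omega>)) \<longlonglongrightarrow> f (U \<omega>) * exp (quadratic_form A (U \<omega>) / 2)"
      unfolding g_def by (intro tendsto_intros) auto
  next
    show "\<forall>\<^sub>F n in sequentially. (\<integral>\<^sup>+\<omega>. ennreal (\<bar>g n (W n \<omega>)\<bar> powr p) \<partial>(\<Pi>\<^sub>M l\<in>UNIV. \<Omega>))
        \<le> ennreal (K powr p * (1 / sqrt (1 - e)) ^ CARD('m))"
      using eventually_quadratic_form_le[OF A' de(1) c(3)]
    proof eventually_elim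
      case (elim n)
      \<comment> \<open>Raising to the power \<open>p\<close> turns the exponent
        \<open>d / 2\<close> into \<open>e / 2\<close>, for which the walk has a square-exponential
        moment bounded in its length.\<close>
      have "\<bar>g n v\<bar> powr p \<le> K powr p * exp (e / 2 * (v \<bullet> v))" for v
      proof -
        have "\<bar>g n v\<bar> powr p \<le> (K * exp (d / 2 * (v \<bullet> v))) powr p"
          using de K elim[rule_format, of v] unfolding g_def abs_mult
          by (intro powr_mono2 mult_mono) auto
        also have "\<dots> = K powr p * exp (p * (d / 2 * (v \<bullet> v)))"
          using K by (simp add: powr_mult exp_powr_real mult.commute)
        also have "p * (d / 2 * (v \<bullet> v)) = e / 2 * (v \<bullet> v)"
          by (simp flip: de(6))
        finally show ?thesis .
      qed
      then have "(\<integral>\<^sup>+\<omega>. ennreal (\<bar>g n (W n \<omega>)\<bar> powr p) \<partial>(\<Pi>\<^sub>M l\<in>UNIV. \<Omega>))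
          \<le> (\<integral>\<^sup>+\<omega>. ennreal (K powr p) * ennreal (exp (e / 2 * (W n \<omega> \<bullet> W n \<omega>))) \<partial>(\<Pi>\<^sub>M l\<in>UNIV. \<Omega>))"
        by (intro nn_integral_mono) (simp flip: ennreal_mult)
      also have "\<dots> = ennreal (K powr p) * (\<integral>\<^sup>+\<omega>. ennreal (exp (e / 2 * (W n \<omega> \<bullet> W n \<omega>))) \<partial>(\<Pi>\<^sub>M l\<in>UNIV. \<Omega>))"
        by (rule nn_integral_cmult) measurable
      also have "\<dots> \<le> ennreal (K powr p) * ennreal ((1 / sqrt (1 - e)) ^ CARD('m))"
        unfolding W_def
      proof (intro mult_left_mono nn_integral_PiM_exp_square_le[OF \<Omega> meas(1)])
        fix l
        have "(\<integral>\<^sup>+x. ennreal (exp (e / 2 * (Y (k n l) x)\<^sup>2)) \<partial>\<Omega>)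
            = (\<integral>\<^sup>+y. ennreal (exp (e / 2 * y\<^sup>2)) \<partial>distr \<Omega> borel (Y (k n l)))"
          using meas(1) by (subst nn_integral_distr) auto
        also have "\<dots> \<le> ennreal (1 / sqrt (1 - e))"
          unfolding Y using nn_integral_exp_square_normalized_walk_le[OF de(3,4)]
          by (subst nn_integral_distr) auto
        finally show "(\<integral>\<^sup>+x. ennreal (exp (e / 2 * (Y (k n l) x)\<^sup>2)) \<partial>\<Omega>) \<le> ennreal (1 / sqrt (1 - e))" .
      qed (use de in auto)
      also have "\<dots> = ennreal (K powr p * (1 / sqrt (1 - e)) ^ CARD('m))"
        using de by (simp add: ennreal_mult)
      finally show ?case .
    qed
  qed (use de in \<open>auto simp: g_def\<close>)
  moreover have "(\<integral>\<omega>. f (U \<omega>) * exp (quadratic_form A (U \<omega>) / 2) \<partial>(\<Pi>\<^sub>M l\<in>UNIV. \<Omega>))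
      = (1 / sqrt (2 * pi)) ^ CARD('m) * (\<integral>z. f z * exp (- quadratic_form (mat 1 - A) z / 2) \<partial>lborel)"
  proof -
    have "exp (quadratic_form A z / 2) * exp (- (z \<bullet> z) / 2) = exp (- quadratic_form (mat 1 - A) z / 2)" for z
      by (simp add: quadratic_form_def matrix_vector_mult_diff_rdistrib inner_diff_right diff_divide_distrib flip: exp_add)
    then have "(\<integral>z. f z * exp (quadratic_form A z / 2) * exp (- (z \<bullet> z) / 2) \<partial>lborel)
        = (\<integral>z. f z * exp (- quadratic_form (mat 1 - A) z / 2) \<partial>lborel)"
      by (simp add: mult.assoc)
    moreover have "(\<integral>\<omega>. f (U \<omega>) * exp (quadratic_form A (U \<omega>) / 2) \<partial>(\<Pi>\<^sub>M l\<in>UNIV. \<Omega>))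
        = (\<integral>x. f (vec_lambda x) * exp (quadratic_form A (vec_lambda x) / 2) \<partial>(\<Pi>\<^sub>M l\<in>UNIV. std_normal_distribution))"
      unfolding U_def
      using integral_PiM_coordinatewise[OF \<Omega>, of "\<lambda>_. Z" "\<lambda>v. f v * exp (quadratic_form A v / 2)"]
      by (simp add: meas Z)
    ultimately show ?thesis
      using integral_PiM_std_normal[of "\<lambda>v. f v * exp (quadratic_form A v / 2)"] by simp
  qed
  ultimately show ?thesis
    by (simp add: g_def)
qed

section \<open>Identification of the limit law\<close>

text \<open>With \<open>C\<close> inverse to \<open>Q\<close>, the constant in the density is the
  total Gaussian integral of \<open>Q\<close>, because \<open>det C = 1 / det Q\<close>. The
  quotient matches the shape of the tilted expectations.\<close>

lemma integral_centred_normal: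
  fixes C Q :: "real^'m^'m" and f :: "real^'m \<Rightarrow> real"
  assumes Q: "pos_definite Q" and C: "C ** Q = mat 1" and [measurable]: "f \<in> borel_measurable borel"
  shows "(\<integral>x. f x \<partial>centred_normal C)
    = (\<integral>x. f x * exp (- quadratic_form Q x / 2) \<partial>lborel) / (\<integral>x. exp (- quadratic_form Q x / 2) \<partial>lborel)"
proof -
  define D where "D = sqrt ((2 * pi) ^ CARD('m) * det C)"
  have det: "det C = 1 / det Q" and "0 < det Q"
    using C nn_integral_gaussian(1)[OF Q] det_mul[of C Q] by (auto simp: field_simps)
  then have "0 < D" by (simp add: D_def)
  have norm: "(\<integral>x. exp (- quadratic_form Q x / 2) \<partial>lborel) = D"
    using nn_integral_gaussian(2)[OF Q] \<open>0 < det Q\<close>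
    by (subst integral_eq_nn_integral) (auto simp: D_def det)
  have "(\<integral>x. f x \<partial>centred_normal C) = (\<integral>x. exp (- quadratic_form Q x / 2) / D * f x \<partial>lborel)"
    unfolding centred_normal_def matrix_inv_eqI[OF C] quadratic_form_def[symmetric] D_def[symmetric]
    using \<open>0 < D\<close> by (intro integral_real_density) auto
  also have "\<dots> = (\<integral>x. f x * exp (- quadratic_form Q x / 2) / D \<partial>lborel)"
    by (simp add: mult.commute)
  also have "\<dots> = (\<integral>x. f x * exp (- quadratic_form Q x / 2) \<partial>lborel) / D"
    by simp
  finally show ?thesis unfolding norm .
qed

lemma borel_measurable_normalized_spin_sums:
  assumes "curie_weiss P J gs X"
  shows "normalized_spin_sums gs X \<in> borel_measurable P"
proof -
  interpret curie_weiss P J gs X by fact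
  show ?thesis
    unfolding normalized_spin_sums_def
    by (intro measurable_vec_lambda borel_measurable_divide borel_measurable_sum spin_measurable borel_measurable_const)
qed

text \<open>The coupling regime enters only through the inequality \<open>less\<close> and the
  inverse relation \<open>C\<close>, so one argument serves both regimes.\<close>

proposition curie_weiss_clt:
  fixes J C :: "real^'m^'m" and \<alpha> :: "real^'m" and gs :: "nat \<Rightarrow> 'm \<Rightarrow> nat"
  assumes total: "\<And>N. (\<Sum>l\<in>UNIV. gs N l) = N"
    and gs: "\<And>l. filterlim (\<lambda>N. gs N l) at_top sequentially"
    and \<alpha>: "\<And>l. (\<lambda>N. real (gs N l) / real N) \<longlonglongrightarrow> \<alpha> $ l"
    and J: "transpose J = J"
    and cw: "\<And>N. curie_weiss (P N) J (gs N) (X N)"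
    and less: "\<And>x. x \<noteq> 0 \<Longrightarrow> quadratic_form (sqrt_diag \<alpha> ** J ** sqrt_diag \<alpha>) x < x \<bullet> x"
    and C: "C ** (mat 1 - sqrt_diag \<alpha> ** J ** sqrt_diag \<alpha>) = mat 1"
  shows "weakly_converges (\<lambda>N. distr (P N) borel (normalized_spin_sums (gs N) (X N))) (centred_normal C)"
  unfolding weakly_converges_def
proof safe
  fix f :: "real^'m \<Rightarrow> real"
  assume f: "continuous_on UNIV f" "bounded (range f)"
  define A where "A = sqrt_diag \<alpha> ** J ** sqrt_diag \<alpha>"
  define A' where "A' N = rescaled_coupling J (gs N)" for N
  define V where "V N \<omega> = (\<chi> l. normalized_walk (gs N l) (\<omega> l))" for N \<omega>
  define k where "k = (1 / sqrt (2 * pi)) ^ CARD('m)"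
  have "k \<noteq> 0" by (simp add: k_def)
  have f_meas [measurable]: "f \<in> borel_measurable borel"
    using f(1) by (rule borel_measurable_continuous_onI)
  have "(\<lambda>N. sqrt_diag (\<chi> l. real (gs N l) / real N)) \<longlonglongrightarrow> sqrt_diag \<alpha>"
    unfolding diag_matrix_def
    by (intro tendsto_vec_lambda) (auto intro!: tendsto_intros \<alpha>)
  then have A': "A' \<longlonglongrightarrow> A"
    unfolding A'_def A_def rescaled_coupling_def total matrix_matrix_mult_def
    by (intro tendsto_vec_lambda) (auto intro!: tendsto_intros)
  have "transpose A = A"
    by (simp add: A_def matrix_transpose_mul J matrix_mul_assoc)
  then have "transpose (mat 1 - A) = mat 1 - A"
    by (auto simp: vec_eq_iff transpose_def mat_def)
  then have Q: "pos_definite (mat 1 - A)"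
    using less unfolding pos_definite_def A_def[symmetric]
    by (auto simp: quadratic_form_def matrix_vector_mult_diff_rdistrib inner_diff_right)
  have lim: "(\<lambda>N. \<integral>\<omega>. h (V N \<omega>) * exp (quadratic_form (A' N) (V N \<omega>) / 2) \<partial>free_space)
      \<longlonglongrightarrow> k * (\<integral>z. h z * exp (- quadratic_form (mat 1 - A) z / 2) \<partial>lborel)"
    if "continuous_on UNIV h" "bounded (range h)" for h :: "real^'m \<Rightarrow> real"
    unfolding V_def k_def by (rule tilted_walk_limit[OF gs A' less[folded A_def] that])
  have "(\<integral>z. exp (- quadratic_form (mat 1 - A) z / 2) \<partial>lborel) \<noteq> 0"
    using nn_integral_gaussian[OF Q] by (subst integral_eq_nn_integral) auto
  \<comment> \<open>Numerator and denominator are the limit statement for \<open>f\<close> and for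
    the constant 1; the common factor \<open>k\<close> later cancels.\<close>
  then have "(\<lambda>N. (\<integral>\<omega>. f (V N \<omega>) * exp (quadratic_form (A' N) (V N \<omega>) / 2) \<partial>free_space)
          / (\<integral>\<omega>. exp (quadratic_form (A' N) (V N \<omega>) / 2) \<partial>free_space))
      \<longlonglongrightarrow> (k * (\<integral>z. f z * exp (- quadratic_form (mat 1 - A) z / 2) \<partial>lborel))
          / (k * (\<integral>z. exp (- quadratic_form (mat 1 - A) z / 2) \<partial>lborel))"
    using \<open>k \<noteq> 0\<close> lim[of "\<lambda>_. 1"] by (intro tendsto_divide lim f) auto
  also have "(\<lambda>N. (\<integral>\<omega>. f (V N \<omega>) * exp (quadratic_form (A' N) (V N \<omega>) / 2) \<partial>free_space)
          / (\<integral>\<omega>. exp (quadratic_form (A' N) (V N \<omega>) / 2) \<partial>free_space))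
      = (\<lambda>N. \<integral>x. f x \<partial>distr (P N) borel (normalized_spin_sums (gs N) (X N)))"
    by (simp add: integral_distr borel_measurable_normalized_spin_sums[OF cw]
        curie_weiss.expectation_eq_tilted_free[OF cw] V_def A'_def)
  also have "(k * (\<integral>z. f z * exp (- quadratic_form (mat 1 - A) z / 2) \<partial>lborel))
          / (k * (\<integral>z. exp (- quadratic_form (mat 1 - A) z / 2) \<partial>lborel)) = (\<integral>x. f x \<partial>centred_normal C)"
    using \<open>k \<noteq> 0\<close> integral_centred_normal[OF Q C[folded A_def] f_meas] by simp
  finally show "(\<lambda>N. \<integral>x. f x \<partial>distr (P N) borel (normalized_spin_sums (gs N) (X N))) \<longlonglongrightarrow> (\<integral>x. f x \<partial>centred_normal C)" .
qed

theorem theorem11: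
  fixes J \<Sigma> :: "real^'m^'m"
    and \<alpha> :: "real^'m"
    and gs :: "nat \<Rightarrow> 'm \<Rightarrow> nat"
    and P :: "nat \<Rightarrow> 'a measure"
    and X :: "nat \<Rightarrow> 'm \<Rightarrow> nat \<Rightarrow> 'a \<Rightarrow> real"
  assumes "\<And>N. (\<Sum>l\<in>UNIV. gs N l) = N"
    and "\<And>l. filterlim (\<lambda>N. gs N l) at_top sequentially"
    and "\<And>l. (\<lambda>N. real (gs N l) / real N) \<longlonglongrightarrow> \<alpha> $ l"
    and "\<And>l. 0 \<le> \<alpha> $ l"
    and "(\<Sum>l\<in>UNIV. \<alpha> $ l) = 1"
    and "pos_semidefinite J"
    and "\<And>N. curie_weiss (P N) J (gs N) (X N)"
    and "(\<exists>\<beta>. homogeneous_coupling J \<beta> \<and> \<beta> < 1 \<and> \<Sigma> = const_matrix (\<beta> / (1 - \<beta>))) \<or>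
         (heterogeneous_coupling J \<and> pos_definite (H_matrix J \<alpha>) \<and> \<Sigma> = matrix_inv (H_matrix J \<alpha>))"
  shows "weakly_converges
           (\<lambda>N. distr (P N) borel (normalized_spin_sums (gs N) (X N)))
           (centred_normal
              (mat 1 + diag_matrix (\<chi> l. sqrt (\<alpha> $ l)) ** \<Sigma> ** diag_matrix (\<chi> l. sqrt (\<alpha> $ l))))"
proof (rule curie_weiss_clt[OF assms(1,2,3) _ assms(7)])
  show "transpose J = J"
    using assms(6) by (simp add: pos_semidefinite_def)
  show "quadratic_form (sqrt_diag \<alpha> ** J ** sqrt_diag \<alpha>) x < x \<bullet> x" if "x \<noteq> 0" for x
    using assms(8)
  proof (elim disjE exE conjE)
    fix \<beta> assume "homogeneous_coupling J \<beta>" "\<beta> < 1"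
    then show ?thesis
      using homogeneous_pos_definite[OF assms(4,5) _ _ that] by (simp add: homogeneous_coupling_def)
  next
    assume "heterogeneous_coupling J" "pos_definite (H_matrix J \<alpha>)"
    then show ?thesis
      unfolding heterogeneous_coupling_def using assms(4) that by (rule heterogeneous_pos_definite)
  qed
  \<comment> \<open>Both choices of \<open>\<Sigma>\<close> satisfy this identity, which is all that
    inverting the limiting form asks of them.\<close>
  have "\<Sigma> - \<Sigma> ** diag_matrix \<alpha> ** J = J"
    using assms(8) homogeneous_resolvent[OF assms(5)] heterogeneous_resolvent[of J \<alpha>]
    by (auto simp: homogeneous_coupling_def heterogeneous_coupling_def)
  then show "(mat 1 + sqrt_diag \<alpha> ** \<Sigma> ** sqrt_diag \<alpha>) ** (mat 1 - sqrt_diag \<alpha> ** J ** sqrt_diag \<alpha>) = mat 1"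
    using assms(4) by (intro limit_covariance_inverse)
qed

end
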